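(* Let $m,n$ be integers with $0\le m<n$. Then the Legendre polynomials $P_m$ and $P_n$ have no common nonzero complex root. Moreover, with the greatest common divisor in $\mathbb{Q}[x]$ normalized to be monic, \[ \gcd(P_m,P_n)=\begin{cases} x,&\text{if both } m \text{ and } n \text{ are odd},\\ 1,&\text{otherwise}.\end{cases} \]
   Context: For an integer $n\ge 0$, the Legendre polynomial is $P_n(x)=\frac{1}{2^n n!}\frac{d^n}{dx^n}(x^2-1)^n\in\mathbb{Q}[x]$. *)

theory Defs
  imports
    "HOL-Computational_Algebra.Polynomial_Factorial"
    "HOL-Computational_Algebra.Field_as_Ring"
begin

text \<open>Rodrigues' formula; \<open>[:-1, 0, 1:]\<close> is $x^2 - 1$.\<close>

definition legendre_poly :: "nat \<Rightarrow> rat poly" where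
  "legendre_poly n = smult (1 / (2 ^ n * fact n)) ((pderiv ^^ n) ([:-1, 0, 1:] ^ n))"

text \<open>
  The type class operation \<open>gcd\<close> on \<open>rat poly\<close> is normalized. The unit factor of a nonzero
  rational being the number itself, normalized means monic, as the following lemma records.
\<close>

lemma lead_coeff_gcd_rat_poly:
  fixes p q :: "rat poly"
  assumes "p \<noteq> 0 \<or> q \<noteq> 0"
  shows "lead_coeff (gcd p q) = 1"
proof -
  have "gcd p q \<noteq> 0"
    using assms by simp
  hence "unit_factor (gcd p q) = 1"
    by (simp add: unit_factor_gcd)
  thus ?thesis
    by (simp add: unit_factor_poly_def one_pCons)
qed

end

theory Submission
  imports Defs
begin

text \<open>
  Substitute \<open>x = 1 + 2 t\<close>, so that \<open>P\<^sub>n\<close> becomes \<open>p\<^sub>n = \<Sum>k. (n choose k) (n + k choose k) t ^ k\<close>, and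
  work 2-adically. The Newton polygon of \<open>p\<^sub>n\<close> has one edge for each binary digit 1 of \<open>n\<close>: the
  digit at position \<open>a\<close> gives \<open>q = 2 ^ a\<close> roots of valuation \<open>-1/q\<close>. Let \<open>g\<close> be an irreducible common
  factor of \<open>p\<^sub>m\<close> and \<open>p\<^sub>n\<close> other than \<open>1 + 2 t\<close>. It has an edge of slope \<open>1/q\<close> for some digit
  position \<open>a \<ge> 1\<close> common to \<open>m\<close> and \<open>n\<close>, and as its endpoints are lattice points, that edge has
  length at least \<open>q\<close>.

  Let \<open>U\<close> be the primitive of \<open>p\<^sub>m p\<^sub>n\<close> vanishing at \<open>t = 0\<close>. By the Legendre equation, \<open>U\<close> is a
  multiple of \<open>t (t + 1) (p\<^sub>n' p\<^sub>m - p\<^sub>m' p\<^sub>n)\<close>, so \<open>g\<close> divides \<open>U\<close>, and \<open>g\<^sup>2\<close> divides \<open>U'\<close>; hence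
  \<open>g\<^sup>3\<close> divides \<open>U\<close> and \<open>U\<close> has an edge of slope \<open>1/q\<close> and length at least \<open>3 q\<close>. On the other hand,
  Adams' formula expands \<open>p\<^sub>m p\<^sub>n\<close> in the \<open>p\<^sub>K\<close> with explicit coefficients. The resulting double sum
  for \<open>U\<close> has exactly two terms of minimal weight for the slope \<open>1/q\<close>, by counting carries in binary
  additions, and they are \<open>2 q\<close> apart: a contradiction.
\<close>

section \<open>Binary digit sums and carries\<close>

text \<open>Taken separately, the polygons of \<open>p_m\<close> and \<open>p_n\<close> do not
  forbid a common factor when \<open>m\<close> and \<open>n\<close> share a binary digit. Hence a
  polynomial built from both, in which \<open>g\<close> occurs three times while the edge has room
  for only two pieces of length \<open>q\<close>. After the substitution the coefficients are
  quotients of factorials, so Legendre's formula turns 2-adic valuations into digit sums and carry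
  counts. Let \<open>z\<close> consist of the binary digits common to \<open>m\<close> and
  \<open>n\<close> below position \<open>a\<close>. The two minimal terms come from the summands
  \<open>r = z\<close> and \<open>r = z + q\<close> of Adams' formula; the degrees
  \<open>m + n - 2 r\<close> of their \<open>p_K\<close> differ by \<open>2 q\<close>, and so do the
  positions of the terms. Position \<open>a = 0\<close> is set apart: for odd \<open>n\<close> the
  factor \<open>1 + 2 t\<close> of \<open>p_n\<close> already takes up the whole edge of slope 1,
  which has length 1. This factor is the source of the gcd \<open>x\<close>.\<close>

fun bitsum :: "nat \<Rightarrow> nat" where
  "bitsum n = (if n = 0 then 0 else n mod 2 + bitsum (n div 2))"

declare bitsum.simps [simp del]

lemma bitsum_0 [simp]: "bitsum 0 = 0"
  by (simp add: bitsum.simps)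

lemma bitsum_double [simp]: "bitsum (2 * n) = bitsum n"
  by (cases "n = 0") (simp_all add: bitsum.simps [of "2 * n"])

lemma bitsum_Suc_double [simp]: "bitsum (Suc (2 * n)) = Suc (bitsum n)"
  by (simp add: bitsum.simps [of "Suc (2 * n)"])

lemma bitsum_1 [simp]: "bitsum (Suc 0) = 1"
  using bitsum_Suc_double [of 0] by simp

lemma bitsum_pos: "n > 0 \<Longrightarrow> bitsum n > 0"
proof (induction n rule: less_induct)
  case (less n)
  show ?case
  proof (cases "even n")
    case True
    then obtain k where "n = 2 * k" by blast
    then show ?thesis using less by auto
  next
    case False
    then obtain k where "n = Suc (2 * k)" by (auto elim: oddE)
    then show ?thesis by simp
  qed
qed

lemma bitsum_mult_power2_add:
  assumes "b < 2 ^ k"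
  shows "bitsum (a * 2 ^ k + b) = bitsum a + bitsum b"
  using assms
proof (induction k arbitrary: a b)
  case 0
  then show ?case by simp
next
  case (Suc k)
  show ?case
  proof (cases "even b")
    case True
    then obtain c where c: "b = 2 * c" by blast
    have "a * 2 ^ Suc k + b = 2 * (a * 2 ^ k + c)" by (simp add: c algebra_simps)
    then have "bitsum (a * 2 ^ Suc k + b) = bitsum (a * 2 ^ k + c)"
      by (simp only: bitsum_double)
    then show ?thesis using Suc c by simp
  next
    case False
    then obtain c where c: "b = Suc (2 * c)" by (auto elim: oddE)
    have "a * 2 ^ Suc k + b = Suc (2 * (a * 2 ^ k + c))" by (simp add: c algebra_simps)
    then have "bitsum (a * 2 ^ Suc k + b) = Suc (bitsum (a * 2 ^ k + c))"
      by (simp only: bitsum_Suc_double)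
    then show ?thesis using Suc c by simp
  qed
qed

lemma bitsum_power2 [simp]: "bitsum (2 ^ k) = 1"
  using bitsum_mult_power2_add [of 0 k 1] by simp

text \<open>Each carry replaces two ones by a single one. The induction strips the last digits; for
  two odd numbers the carry is a further summand 1, handled by a second use of the induction
  hypothesis.\<close>

lemma bitsum_add_le: "bitsum (a + b) \<le> bitsum a + bitsum b"
proof (induction "a + b" arbitrary: a b rule: less_induct)
  case less
  have IH: "bitsum (c + d) \<le> bitsum c + bitsum d" if "c + d < a + b" for c d
    using less that by blast
  obtain c where c: "a = 2 * c \<or> a = Suc (2 * c)" by (metis oddE evenE Suc_eq_plus1)
  obtain d where d: "b = 2 * d \<or> b = Suc (2 * d)" by (metis oddE evenE Suc_eq_plus1)
  show ?case
  proof (cases "a + b = 0")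
    case True
    then show ?thesis by simp
  next
    case False
    consider "a = 2 * c" "b = 2 * d" | "a = Suc (2 * c)" "b = 2 * d"
      | "a = 2 * c" "b = Suc (2 * d)" | "a = Suc (2 * c)" "b = Suc (2 * d)"
      using c d by blast
    then show ?thesis
    proof cases
      case 1
      then have "a + b = 2 * (c + d)" by simp
      then have "bitsum (a + b) = bitsum (c + d)" by (simp only: bitsum_double)
      moreover have "c + d < a + b" using 1 False by linarith
      ultimately show ?thesis using 1 IH [of c d] by simp
    next
      case 2
      then have "a + b = Suc (2 * (c + d))" by simp
      then have "bitsum (a + b) = Suc (bitsum (c + d))" by (simp only: bitsum_Suc_double)
      then show ?thesis using 2 IH [of c d] False by simp
    next
      case 3
      then have "a + b = Suc (2 * (c + d))" by simp
      then have "bitsum (a + b) = Suc (bitsum (c + d))" by (simp only: bitsum_Suc_double)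
      then show ?thesis using 3 IH [of c d] False by simp
    next
      case 4
      then have "a + b = 2 * (c + d + 1)" by simp
      then have *: "bitsum (a + b) = bitsum (c + d + 1)" by (simp only: bitsum_double)
      show ?thesis
      proof (cases "c + d = 0")
        case True
        then show ?thesis using 4 * by simp
      next
        case False
        then have "bitsum (c + d + 1) \<le> bitsum (c + d) + 1"
          using IH [of "c + d" 1] 4 by simp
        then show ?thesis using * 4 IH [of c d] by simp
      qed
    qed
  qed
qed

text \<open>By Kummer's theorem this is the number of carries in the binary addition of
  \<open>a\<close> and \<open>b\<close>, and the 2-adic valuation of
  \<open>(a + b) choose a\<close>.\<close>

definition carries :: "nat \<Rightarrow> nat \<Rightarrow> int" where
  "carries a b = int (bitsum a) + int (bitsum b) - int (bitsum (a + b))"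

lemma carries_nonneg: "carries a b \<ge> 0"
  using bitsum_add_le [of a b] by (simp add: carries_def)

lemma carries_commute: "carries a b = carries b a"
  by (simp add: carries_def add.commute)

lemma carries_0_right [simp]: "carries a 0 = 0"
  by (simp add: carries_def)

text \<open>In the recursion on last digits only the case of two odd numbers is decisive: the carry
  makes the left side positive, and the common last digit makes \<open>and a b\<close> odd.\<close>

lemma carries_eq_0_iff: "carries a b = 0 \<longleftrightarrow> and a b = 0"
proof (induction "a + b" arbitrary: a b rule: less_induct)
  case less
  obtain c where c: "a = 2 * c \<or> a = Suc (2 * c)" by (metis oddE evenE Suc_eq_plus1)
  obtain d where d: "b = 2 * d \<or> b = Suc (2 * d)" by (metis oddE evenE Suc_eq_plus1)
  show ?case
  proof (cases "a + b = 0")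
    case True
    then show ?thesis by (simp add: carries_def)
  next
    case False
    consider "a = 2 * c" "b = 2 * d" | "a = Suc (2 * c)" "b = 2 * d"
      | "a = 2 * c" "b = Suc (2 * d)" | "a = Suc (2 * c)" "b = Suc (2 * d)"
      using c d by blast
    then show ?thesis
    proof cases
      case 1
      then have "a + b = 2 * (c + d)" by simp
      then have "bitsum (a + b) = bitsum (c + d)" by (simp only: bitsum_double)
      moreover have "and a b = 2 * and c d" unfolding and_rec [of a b] using 1 by simp
      moreover have "c + d < a + b" using 1 False by linarith
      ultimately show ?thesis using 1 less [of c d] by (auto simp add: carries_def)
    next
      case 2
      then have "a + b = Suc (2 * (c + d))" by simp
      then have "bitsum (a + b) = Suc (bitsum (c + d))" by (simp only: bitsum_Suc_double)
      moreover have "and a b = 2 * and c d" unfolding and_rec [of a b] using 2 by simp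
      moreover have "c + d < a + b" using 2 False by linarith
      ultimately show ?thesis using 2 less [of c d] by (auto simp add: carries_def)
    next
      case 3
      then have "a + b = Suc (2 * (c + d))" by simp
      then have "bitsum (a + b) = Suc (bitsum (c + d))" by (simp only: bitsum_Suc_double)
      moreover have "and a b = 2 * and c d" unfolding and_rec [of a b] using 3 by simp
      moreover have "c + d < a + b" using 3 False by linarith
      ultimately show ?thesis using 3 less [of c d] by (auto simp add: carries_def)
    next
      case 4
      then have "a + b = 2 * (c + d + 1)" by simp
      then have "bitsum (a + b) = bitsum (c + d + 1)" by (simp only: bitsum_double)
      then have "carries a b > 0"
        using bitsum_add_le [of "c + d" 1] bitsum_add_le [of c d] 4 by (simp add: carries_def)
      moreover have "odd (and a b)" using 4 by (simp add: even_and_iff)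
      ultimately show ?thesis by (auto dest: odd_pos)
    qed
  qed
qed

lemma carries_0_add_less:
  assumes "carries a b = 0" "a < 2 ^ k" "b < 2 ^ k"
  shows "a + b < 2 ^ k"
proof -
  have "and a b = 0" using assms(1) by (simp add: carries_eq_0_iff)
  then have "a + b = or a b"
    by (simp add: disjunctive_add_eq_or)
  also have "\<dots> < 2 ^ k" using assms(2,3) by (metis take_bit_nat_eq_self_iff take_bit_or)
  finally show ?thesis .
qed

text \<open>The low blocks do not overflow, so no carry passes between the blocks.\<close>

lemma carries_split:
  assumes "b < 2 ^ k" "d < 2 ^ k" "b + d < 2 ^ k"
  shows "carries (a * 2 ^ k + b) (c * 2 ^ k + d) = carries a c + carries b d"
proof -
  have "a * 2 ^ k + b + (c * 2 ^ k + d) = (a + c) * 2 ^ k + (b + d)"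
    by (simp add: algebra_simps)
  then show ?thesis
    by (simp only: carries_def bitsum_mult_power2_add assms)
qed

lemma bitsum_le: "n < 2 ^ k \<Longrightarrow> bitsum n \<le> k"
proof (induction k arbitrary: n)
  case 0
  then show ?case by simp
next
  case (Suc k)
  have "bitsum n = bitsum (n div 2) + n mod 2"
    by (cases "n = 0") (simp_all add: bitsum.simps [of n])
  moreover have "bitsum (n div 2) \<le> k"
    using Suc by (intro Suc.IH) auto
  ultimately show ?case by simp
qed

lemma bitsum_mask: "bitsum (2 ^ k - 1) = k"
proof (induction k)
  case (Suc k)
  have "(1::nat) \<le> 2 ^ k" by simp
  then have "2 ^ Suc k - 1 = Suc (2 * (2 ^ k - 1))" unfolding power_Suc by arith
  then show ?case using Suc bitsum_Suc_double [of "2 ^ k - 1"] by simp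
qed simp

lemma eq_mask_if_bitsum_ge:
  assumes "n < 2 ^ k" "bitsum n \<ge> k"
  shows "n = 2 ^ k - 1"
  using assms
proof (induction k arbitrary: n)
  case (Suc k)
  have n: "bitsum n = n mod 2 + bitsum (n div 2)"
    by (cases "n = 0") (simp_all add: bitsum.simps [of n])
  have lt: "n div 2 < 2 ^ k" using Suc.prems by auto
  then have "bitsum (n div 2) \<le> k" by (rule bitsum_le)
  then have "bitsum (n div 2) = k" "n mod 2 = 1" using n Suc.prems by auto
  then have "n div 2 = 2 ^ k - 1" using Suc.IH lt by simp
  then have "n = 2 * (2 ^ k - 1) + 1" using \<open>n mod 2 = 1\<close> by presburger
  moreover have "(2::nat) ^ k \<ge> 1" by simp
  ultimately show ?case unfolding power_Suc by linarith
qed simp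

text \<open>Each digit 1 contributes at most \<open>2 ^ k\<close>. This makes the low-block weight
  \<open>2 ^ a * bitsum j - j\<close> nonnegative for \<open>j < 2 ^ Suc a\<close>.\<close>

lemma le_power2_mult_bitsum: "n < 2 ^ Suc k \<Longrightarrow> n \<le> 2 ^ k * bitsum n"
proof (induction k arbitrary: n)
  case 0
  then have "n = 0 \<or> n = 1" by auto
  then show ?case by auto
next
  case (Suc k)
  show ?case
  proof (cases "even n")
    case True
    then obtain c where c: "n = 2 * c" by blast
    then have "c \<le> 2 ^ k * bitsum c" using Suc by simp
    then show ?thesis using c by simp
  next
    case False
    then obtain c where c: "n = Suc (2 * c)" by (auto elim: oddE)
    then have "c \<le> 2 ^ k * bitsum c" using Suc by simp
    moreover have "(1::nat) \<le> 2 ^ k" by simp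
    ultimately show ?thesis unfolding c bitsum_Suc_double power_Suc mult_Suc_right mult.assoc by linarith
  qed
qed

text \<open>Passing from \<open>a\<close> to \<open>a + d\<close> raises the digit sum by at most
  \<open>bitsum d\<close>, hence by at most \<open>d\<close>, against a gain of
  \<open>2 * d\<close>.\<close>

lemma double_minus_bitsum_less: "2 * int a - int (bitsum a) < 2 * int b - int (bitsum b)" if less: "a < b"
proof -
  obtain d where d: "b = a + d" "d > 0" using less_imp_add_positive [OF less] by auto
  have le: "bitsum d \<le> d" for d
  proof (induction d)
    case (Suc d)
    have "bitsum (Suc d) \<le> bitsum d + bitsum 1" using bitsum_add_le [of d 1] by simp
    then have "bitsum (Suc d) \<le> bitsum d + 1" by simp
    then show ?case using Suc by linarith
  qed simp
  have "bitsum (a + d) \<le> bitsum a + d"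
    using le [of d] bitsum_add_le [of a d] by simp
  then have "int (bitsum b) \<le> int (bitsum a) + int d"
    unfolding d(1) of_nat_add [symmetric] of_nat_le_iff .
  then show ?thesis using d by simp
qed

section \<open>The 2-adic valuation and Newton polygons\<close>

text \<open>Note that \<open>val2 0 = 0\<close>.\<close>

definition val2 :: "rat \<Rightarrow> int" where
  "val2 x = int (multiplicity 2 (fst (quotient_of x))) - int (multiplicity 2 (snd (quotient_of x)))"

lemma val2_divide_of_int:
  assumes "a \<noteq> 0" "b \<noteq> 0"
  shows "val2 (of_int a / of_int b) = int (multiplicity 2 a) - int (multiplicity 2 b)"
proof -
  obtain c d where cd: "quotient_of (of_int a / of_int b) = (c, d)" by (metis surj_pair)
  then have "d > 0" by (rule quotient_of_denom_pos)
  have eq: "of_int a / of_int b = (of_int c / of_int d :: rat)"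
    using cd by (rule quotient_of_div)
  then have "of_int (a * d) = (of_int (c * b) :: rat)"
    using \<open>d > 0\<close> assms by (simp add: field_simps)
  then have adcb: "a * d = c * b" by (simp only: of_int_eq_iff)
  then have "c \<noteq> 0" using assms \<open>d > 0\<close> by auto
  have "multiplicity 2 (a * d) = multiplicity 2 a + multiplicity 2 d"
    using assms \<open>d > 0\<close> by (intro prime_elem_multiplicity_mult_distrib) auto
  moreover have "multiplicity 2 (c * b) = multiplicity 2 c + multiplicity 2 b"
    using assms \<open>c \<noteq> 0\<close> by (intro prime_elem_multiplicity_mult_distrib) auto
  ultimately show ?thesis using adcb cd by (simp add: val2_def)
qed

lemma rat_nonzero_cases:
  fixes x :: rat
  assumes "x \<noteq> 0"
  obtains a b where "x = of_int a / of_int b" "a \<noteq> 0" "b \<noteq> 0"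
proof -
  obtain a b where ab: "quotient_of x = (a, b)" by (metis surj_pair)
  then have "x = of_int a / of_int b" "b > 0"
    by (auto intro: quotient_of_div quotient_of_denom_pos)
  then show ?thesis using assms that by (metis division_ring_divide_zero div_0 of_int_0)
qed

lemma val2_mult:
  assumes "x \<noteq> 0" "y \<noteq> 0"
  shows "val2 (x * y) = val2 x + val2 y"
proof -
  obtain a b where ab: "x = of_int a / of_int b" "a \<noteq> 0" "b \<noteq> 0"
    using assms(1) by (rule rat_nonzero_cases)
  obtain c d where cd: "y = of_int c / of_int d" "c \<noteq> 0" "d \<noteq> 0"
    using assms(2) by (rule rat_nonzero_cases)
  have "x * y = of_int (a * c) / of_int (b * d)" using ab cd by simp
  then have "val2 (x * y) = int (multiplicity 2 (a * c)) - int (multiplicity 2 (b * d))"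
    using ab cd by (simp only: val2_divide_of_int mult_eq_0_iff simp_thms)
  also have "multiplicity 2 (a * c) = multiplicity 2 a + multiplicity 2 c"
    using ab cd by (intro prime_elem_multiplicity_mult_distrib) auto
  also have "multiplicity 2 (b * d) = multiplicity 2 b + multiplicity 2 d"
    using ab cd by (intro prime_elem_multiplicity_mult_distrib) auto
  finally show ?thesis
    using ab cd by (simp add: val2_divide_of_int)
qed

lemma val2_of_int: "a \<noteq> 0 \<Longrightarrow> val2 (of_int a) = int (multiplicity 2 a)"
  using val2_divide_of_int [of a 1] by simp

lemma val2_odd: "odd a \<Longrightarrow> val2 (of_int a) = 0"
  using val2_of_int [of a] by (auto simp: not_dvd_imp_multiplicity_0)

lemma val2_odd_nat: "odd n \<Longrightarrow> val2 (of_nat n) = 0"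
  using val2_odd [of "int n"] by simp

lemma val2_1 [simp]: "val2 1 = 0"
  using val2_odd [of 1] by simp

lemma val2_2 [simp]: "val2 2 = 1"
  using val2_of_int [of 2] by simp

lemma val2_minus [simp]: "val2 (- x) = val2 x"
proof (cases "x = 0")
  case False
  then show ?thesis using val2_mult [of "-1" x] val2_odd [of "-1"] by simp
qed simp

lemma val2_inverse:
  assumes "x \<noteq> 0"
  shows "val2 (inverse x) = - val2 x"
  using val2_mult [of x "inverse x"] assms by simp

lemma val2_divide:
  assumes "x \<noteq> 0" "y \<noteq> 0"
  shows "val2 (x / y) = val2 x - val2 y"
  using assms by (simp add: divide_inverse val2_mult val2_inverse)

lemma val2_power: "x \<noteq> 0 \<Longrightarrow> val2 (x ^ n) = int n * val2 x"
  by (induction n) (simp_all add: val2_mult algebra_simps)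

lemma val2_add:
  assumes "x \<noteq> 0" "y \<noteq> 0" "x + y \<noteq> 0" "val2 x \<le> val2 y"
  shows "val2 x \<le> val2 (x + y)"
proof -
  obtain a b where ab: "x = of_int a / of_int b" "a \<noteq> 0" "b \<noteq> 0"
    using assms(1) by (rule rat_nonzero_cases)
  obtain c d where cd: "y = of_int c / of_int d" "c \<noteq> 0" "d \<noteq> 0"
    using assms(2) by (rule rat_nonzero_cases)
  have xb: "x = of_int (a * d) / of_int (b * d)" using ab cd by simp
  have yb: "y = of_int (c * b) / of_int (b * d)" using ab cd by simp
  have sb: "x + y = of_int (a * d + c * b) / of_int (b * d)"
    by (simp only: xb yb of_int_add add_divide_distrib)
  have nz: "b * d \<noteq> 0" "a * d \<noteq> 0" "c * b \<noteq> 0" "a * d + c * b \<noteq> 0"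
    using ab cd assms(3) sb by (auto simp del: of_int_add of_int_mult)
  have "multiplicity 2 (a * d) \<le> multiplicity 2 (c * b)"
    using assms(4) nz unfolding xb yb
    by (simp add: val2_divide_of_int del: of_int_add of_int_mult mult_eq_0_iff)
  then have "2 ^ multiplicity 2 (a * d) dvd a * d + c * b"
    by (intro dvd_add multiplicity_dvd multiplicity_dvd')
  then have "multiplicity 2 (a * d) \<le> multiplicity 2 (a * d + c * b)"
    using nz by (intro multiplicity_geI) auto
  then show ?thesis
    using nz unfolding sb unfolding xb
    by (simp add: val2_divide_of_int del: of_int_add of_int_mult mult_eq_0_iff)
qed

lemma val2_add_less:
  assumes "x \<noteq> 0" "y \<noteq> 0" "val2 x < val2 y"
  shows "x + y \<noteq> 0 \<and> val2 (x + y) = val2 x"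
proof -
  have nz: "x + y \<noteq> 0"
  proof
    assume "x + y = 0"
    then have "y = - x" by (simp add: add_eq_0_iff)
    then show False using assms(3) by simp
  qed
  have ge: "val2 x \<le> val2 (x + y)" using val2_add nz assms by simp
  have "\<not> val2 x < val2 (x + y)"
  proof
    assume *: "val2 x < val2 (x + y)"
    show False
    proof (cases "val2 (x + y) \<le> val2 (- y)")
      case True
      then show False using val2_add [of "x + y" "- y"] nz assms * by simp
    next
      case False
      then show False using val2_add [of "- y" "x + y"] nz assms * by simp
    qed
  qed
  then show ?thesis using nz ge by simp
qed

lemma val2_sum_ge:
  assumes "finite A" "sum f A \<noteq> 0"
    and "\<And>i. i \<in> A \<Longrightarrow> f i \<noteq> 0 \<Longrightarrow> z \<le> val2 (f i)"
  shows "z \<le> val2 (sum f A)"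
  using assms
proof (induction A rule: finite_induct)
  case (insert i A)
  show ?case
  proof (cases "f i = 0 \<or> sum f A = 0")
    case True
    then show ?thesis using insert by auto
  next
    case False
    then have "z \<le> val2 (f i)" "z \<le> val2 (sum f A)" using insert by auto
    then show ?thesis
      using False insert val2_add [of "f i" "sum f A"] val2_add [of "sum f A" "f i"]
      by (cases "val2 (f i) \<le> val2 (sum f A)") (force simp: add.commute)+
  qed
qed simp

lemma val2_sum_unique_min:
  assumes "finite A" "j \<in> A" "f j \<noteq> 0"
    and "\<And>i. i \<in> A \<Longrightarrow> i \<noteq> j \<Longrightarrow> f i \<noteq> 0 \<Longrightarrow> val2 (f j) < val2 (f i)"
  shows "sum f A \<noteq> 0 \<and> val2 (sum f A) = val2 (f j)"
proof -
  have eq: "sum f A = f j + sum f (A - {j})"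
    using assms by (intro sum.remove)
  show ?thesis
  proof (cases "sum f (A - {j}) = 0")
    case True
    then show ?thesis using eq assms by simp
  next
    case False
    have "val2 (f j) + 1 \<le> val2 (sum f (A - {j}))"
      using False assms by (intro val2_sum_ge) force+
    then show ?thesis using val2_add_less [of "f j" "sum f (A - {j})"] eq False assms by simp
  qed
qed

text \<open>
  For \<open>q > 0\<close>, the valuations \<open>q * val2 c\<^sub>k - k\<close> of the monomials of \<open>f\<close> at a point of 2-adic
  valuation \<open>-1/q\<close> have minimum \<open>M\<close>, and \<open>l\<close> and \<open>h\<close> are the first and the last index where it is
  attained: the ends of the edge of slope \<open>1/q\<close> of the Newton polygon (a vertex if \<open>l = h\<close>).
\<close>

definition newton_edge :: "int \<Rightarrow> rat poly \<Rightarrow> int \<Rightarrow> nat \<Rightarrow> nat \<Rightarrow> bool" where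
  "newton_edge q f M l h \<longleftrightarrow>
     (\<forall>k. coeff f k \<noteq> 0 \<longrightarrow> M \<le> q * val2 (coeff f k) - int k) \<and>
     (\<forall>k. coeff f k \<noteq> 0 \<longrightarrow> q * val2 (coeff f k) - int k = M \<longrightarrow> l \<le> k \<and> k \<le> h) \<and>
     coeff f l \<noteq> 0 \<and> q * val2 (coeff f l) - int l = M \<and>
     coeff f h \<noteq> 0 \<and> q * val2 (coeff f h) - int h = M"

lemma newton_edge_exists:
  assumes "f \<noteq> 0"
  obtains M l h where "newton_edge q f M l h"
proof -
  define S where "S = {k. coeff f k \<noteq> 0}"
  define w where "w k = q * val2 (coeff f k) - int k" for k
  have "S \<subseteq> {..degree f}" using le_degree by (auto simp: S_def)
  then have fin: "finite S" by (rule finite_subset) simp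
  have ne: "degree f \<in> S" using assms by (simp add: S_def)
  define M where "M = Min (w ` S)"
  define T where "T = {k \<in> S. w k = M}"
  have "M \<in> w ` S" unfolding M_def using fin ne by (intro Min_in) auto
  then have T: "finite T" "T \<noteq> {}" using fin by (auto simp: T_def)
  have "newton_edge q f M (Min T) (Max T)"
    unfolding newton_edge_def
  proof (intro conjI allI impI)
    fix k assume "coeff f k \<noteq> 0"
    then show "M \<le> q * val2 (coeff f k) - int k"
      using fin unfolding M_def w_def [symmetric] by (intro Min_le) (auto simp: S_def)
  next
    fix k assume "coeff f k \<noteq> 0" "q * val2 (coeff f k) - int k = M"
    then have "k \<in> T" by (auto simp: T_def S_def w_def)
    then show "Min T \<le> k" "k \<le> Max T" using T by auto
  qed (use Min_in [OF T] Max_in [OF T] in \<open>auto simp: T_def S_def w_def\<close>)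
  then show ?thesis using that by blast
qed

lemma newton_edge_unique:
  assumes "newton_edge q f M l h" "newton_edge q f M' l' h'"
  shows "M = M' \<and> l = l' \<and> h = h'"
proof -
  have "M = M'" using assms unfolding newton_edge_def by force
  then show ?thesis using assms unfolding newton_edge_def by (metis antisym)
qed

lemma newton_edge_le: "newton_edge q f M l h \<Longrightarrow> l \<le> h"
  unfolding newton_edge_def by blast

lemma newton_edge_le_degree: "newton_edge q f M l h \<Longrightarrow> h \<le> degree f"
  unfolding newton_edge_def by (blast intro: le_degree)

lemma newton_edge_dvd_diff:
  assumes "newton_edge q f M l h"
  shows "q dvd int h - int l"
proof -
  have "int h - int l = q * (val2 (coeff f h) - val2 (coeff f l))"
    using assms unfolding newton_edge_def by (simp add: algebra_simps)
  then show ?thesis by simp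
qed

text \<open>Dumas' theorem. In the convolution only products of two minimal monomials reach the
  weight \<open>M + M'\<close>, and at each of the two ends there is exactly one such product, so
  nothing cancels there.\<close>

lemma newton_edge_mult:
  assumes q: "q > 0" and f: "newton_edge q f M l h" and g: "newton_edge q g M' l' h'"
  shows "newton_edge q (f * g) (M + M') (l + l') (h + h')"
proof -
  define t where "t k i = coeff f i * coeff g (k - i)" for k i
  have c: "coeff (f * g) k = sum (t k) {..k}" for k
    by (simp add: coeff_mult t_def)
  have w: "q * val2 (t k i) - int k =
      (q * val2 (coeff f i) - int i) + (q * val2 (coeff g (k - i)) - int (k - i))"
    if "i \<le> k" "t k i \<noteq> 0" for k i
    using that by (simp add: t_def val2_mult algebra_simps of_nat_diff)
  have wge: "M + M' \<le> q * val2 (t k i) - int k" if "i \<le> k" "t k i \<noteq> 0" for k i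
    using f g that unfolding w [OF that] newton_edge_def
    by (intro add_mono) (auto simp: t_def)
  have weq: "l \<le> i \<and> i \<le> h \<and> l' \<le> k - i \<and> k - i \<le> h'"
    if "i \<le> k" "t k i \<noteq> 0" "q * val2 (t k i) - int k \<le> M + M'" for k i
  proof -
    have nz: "coeff f i \<noteq> 0" "coeff g (k - i) \<noteq> 0" using that by (auto simp: t_def)
    have "M \<le> q * val2 (coeff f i) - int i" "M' \<le> q * val2 (coeff g (k - i)) - int (k - i)"
      using nz f g unfolding newton_edge_def by blast+
    then have "q * val2 (coeff f i) - int i = M" "q * val2 (coeff g (k - i)) - int (k - i) = M'"
      using w [OF that(1,2)] that(3) by linarith+
    then show ?thesis using nz f g unfolding newton_edge_def by blast
  qed
  have ge: "M + M' \<le> q * val2 (coeff (f * g) k) - int k" if "coeff (f * g) k \<noteq> 0" for k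
  proof (rule ccontr)
    assume "\<not> ?thesis"
    then have less: "q * val2 (coeff (f * g) k) < M + M' + int k" by simp
    \<comment> \<open>Valuations are integers: applying \<open>val2_sum_ge\<close> with the bound
      raised by 1 turns strict inequalities for the terms into a strict inequality for their
      sum.\<close>
    have "val2 (coeff (f * g) k) + 1 \<le> val2 (sum (t k) {..k})"
    proof (rule val2_sum_ge)
      fix i assume "i \<in> {..k}" "t k i \<noteq> 0"
      then have "M + M' + int k \<le> q * val2 (t k i)" using wge [of i k] by simp
      then have "q * val2 (coeff (f * g) k) < q * val2 (t k i)" using less by linarith
      then show "val2 (coeff (f * g) k) + 1 \<le> val2 (t k i)" using q by simp
    qed (use that c in auto)
    then show False by (simp add: c)
  qed
  have ends: "l + l' \<le> k \<and> k \<le> h + h'"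
    if "coeff (f * g) k \<noteq> 0" "q * val2 (coeff (f * g) k) - int k = M + M'" for k
  proof (rule ccontr)
    assume not: "\<not> ?thesis"
    have "val2 (coeff (f * g) k) + 1 \<le> val2 (sum (t k) {..k})"
    proof (rule val2_sum_ge)
      fix i assume i: "i \<in> {..k}" "t k i \<noteq> 0"
      then have "\<not> q * val2 (t k i) - int k \<le> M + M'" using weq [of i k] not by auto
      then have "q * val2 (coeff (f * g) k) < q * val2 (t k i)" using that by linarith
      then show "val2 (coeff (f * g) k) + 1 \<le> val2 (t k i)" using q by simp
    qed (use that c in auto)
    then show False by (simp add: c)
  qed
  have vertex: "coeff (f * g) (i + j) \<noteq> 0 \<and> q * val2 (coeff (f * g) (i + j)) - int (i + j) = M + M'"
    if "i = l \<and> j = l' \<or> i = h \<and> j = h'" for i j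
  proof -
    have nz: "t (i + j) i \<noteq> 0"
      and eq: "q * val2 (t (i + j) i) - int (i + j) = M + M'"
      using that f g w [of i "i + j"] unfolding newton_edge_def by (auto simp: t_def)
    have "sum (t (i + j)) {..i + j} \<noteq> 0 \<and> val2 (sum (t (i + j)) {..i + j}) = val2 (t (i + j) i)"
    proof (rule val2_sum_unique_min)
      fix i' assume i': "i' \<in> {..i + j}" "i' \<noteq> i" "t (i + j) i' \<noteq> 0"
      have "\<not> q * val2 (t (i + j) i') - int (i + j) \<le> M + M'"
        using weq [of i' "i + j"] i' that newton_edge_le [OF f] newton_edge_le [OF g] by auto
      then have "q * val2 (t (i + j) i) < q * val2 (t (i + j) i')" using eq by linarith
      then show "val2 (t (i + j) i) < val2 (t (i + j) i')" using q by simp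
    qed (use nz in auto)
    then show ?thesis using eq by (simp add: c)
  qed
  show ?thesis
    unfolding newton_edge_def using ge ends vertex by blast
qed

lemma newton_edge_factor:
  assumes "q > 0" "newton_edge q (f * g) M l h"
  obtains M\<^sub>1 l\<^sub>1 h\<^sub>1 M\<^sub>2 l\<^sub>2 h\<^sub>2 where "newton_edge q f M\<^sub>1 l\<^sub>1 h\<^sub>1" "newton_edge q g M\<^sub>2 l\<^sub>2 h\<^sub>2"
    "l = l\<^sub>1 + l\<^sub>2" "h = h\<^sub>1 + h\<^sub>2"
proof -
  have "f * g \<noteq> 0" using assms(2) by (auto simp: newton_edge_def)
  then obtain M\<^sub>1 l\<^sub>1 h\<^sub>1 M\<^sub>2 l\<^sub>2 h\<^sub>2
    where e: "newton_edge q f M\<^sub>1 l\<^sub>1 h\<^sub>1" "newton_edge q g M\<^sub>2 l\<^sub>2 h\<^sub>2"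
    using newton_edge_exists by (metis mult_eq_0_iff)
  then show ?thesis
    using that newton_edge_unique [OF assms(2) newton_edge_mult [OF assms(1) e]] by blast
qed

text \<open>Convexity of the polygon: comparing the indices \<open>h\<close> and \<open>l'\<close>
  at both slopes gives \<open>2 * (h - l') \<le> h - l'\<close> over the integers.\<close>

lemma newton_edge_consecutive:
  assumes "newton_edge (2 * q) f M l h" "newton_edge q f M' l' h'"
  shows "h \<le> l'"
proof -
  have "M = 2 * q * val2 (coeff f h) - int h" "M \<le> 2 * q * val2 (coeff f l') - int l'"
    "M' = q * val2 (coeff f l') - int l'" "M' \<le> q * val2 (coeff f h) - int h"
    using assms unfolding newton_edge_def by metis+
  then show ?thesis by linarith
qed

section \<open>Legendre's formula for factorials, and carry patterns\<close>

lemma bitsum_Suc: "int (bitsum (Suc n)) = int (bitsum n) + 1 - val2 (of_nat (Suc n))"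
proof (induction n rule: less_induct)
  case (less n)
  show ?case
  proof (cases "even n")
    case True
    then obtain c where c: "n = 2 * c" by blast
    then have "val2 (of_nat (Suc n)) = 0" by (intro val2_odd_nat) simp
    then show ?thesis by (simp add: c)
  next
    case False
    then obtain c where c: "n = Suc (2 * c)" by (auto elim: oddE)
    have "of_nat (Suc n) = (2 * of_nat (Suc c) :: rat)" by (simp add: c)
    then have "val2 (of_nat (Suc n)) = 1 + val2 (of_nat (Suc c))"
      using val2_mult [of 2 "of_nat (Suc c)"] by (simp del: of_nat_Suc)
    moreover have "bitsum (Suc n) = bitsum (Suc c)"
      using bitsum_double [of "Suc c"] by (simp add: c)
    ultimately show ?thesis using less [of c] by (simp add: c del: of_nat_Suc)
  qed
qed

lemma val2_fact: "val2 (fact n) = int n - int (bitsum n)"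
proof (induction n)
  case (Suc n)
  have "val2 (fact (Suc n)) = val2 (of_nat (Suc n)) + val2 (fact n)"
    using val2_mult [of "of_nat (Suc n)" "fact n"] by (simp del: of_nat_Suc)
  then show ?case using Suc bitsum_Suc [of n] by simp
qed simp

text \<open>By \<open>carries_0_add_less\<close> an overflow of the low blocks needs a common digit,
  and this is also a common digit of the whole numbers.\<close>

lemma carries_ge_1:
  assumes "b < 2 ^ k" "d < 2 ^ k" "b + d \<ge> 2 ^ k"
  shows "carries (a * 2 ^ k + b) (c * 2 ^ k + d) \<ge> 1"
proof (rule ccontr)
  assume "\<not> ?thesis"
  then have "carries (a * 2 ^ k + b) (c * 2 ^ k + d) = 0"
    using carries_nonneg [of "a * 2 ^ k + b" "c * 2 ^ k + d"] by linarith
  then have "and (a * 2 ^ k + b) (c * 2 ^ k + d) = 0" by (simp add: carries_eq_0_iff)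
  then have "take_bit k (and (a * 2 ^ k + b) (c * 2 ^ k + d)) = 0" by simp
  then have "and (take_bit k (a * 2 ^ k + b)) (take_bit k (c * 2 ^ k + d)) = 0"
    by (simp only: take_bit_and)
  moreover have "take_bit k (a * 2 ^ k + b) = b" "take_bit k (c * 2 ^ k + d) = d"
    using assms by (simp_all add: take_bit_eq_mod)
  ultimately have "carries b d = 0" by (simp add: carries_eq_0_iff)
  then show False using carries_0_add_less [of b d k] assms by simp
qed

text \<open>The carry conditions make \<open>l - z\<close>, \<open>l' - z\<close> and
  \<open>z\<close> pairwise disjoint as sets of digits, so \<open>z\<close> holds precisely the
  common digits of \<open>l\<close> and \<open>l'\<close>. This identifies the summand
  \<open>r\<close> of minimal excess.\<close>

lemma nat_eq_and_if_no_carries: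
  assumes "z \<le> l" "z \<le> l'" "carries (l - z) (l' - z) = 0" "carries (l + l' - 2 * z) z = 0"
  shows "z = and l l'"
proof -
  define u w where "u = l - z" and "w = l' - z"
  have uw: "and u w = 0" using assms by (simp add: carries_eq_0_iff u_def w_def)
  have "l + l' - 2 * z = u + w" using assms by (simp add: u_def w_def)
  also have "\<dots> = or u w" using uw by (rule disjunctive_add_eq_or)
  finally have uwz: "and (or u w) z = 0" using assms by (simp add: carries_eq_0_iff)
  then have "and u z = 0" "and w z = 0"
    by (auto simp: bit_eq_iff bit_simps)
  then have "u + z = or u z" "w + z = or w z" by (auto intro: disjunctive_add_eq_or)
  moreover have "l = u + z" "l' = w + z" using assms by (simp_all add: u_def w_def)
  ultimately show ?thesis using uw by (simp add: bit_eq_iff bit_simps) blast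
qed

text \<open>Converse of \<open>nat_eq_and_if_no_carries\<close>: removing the common digits leaves
  two disjoint remainders, and sums of disjoint numbers are \<open>or\<close>.\<close>

lemma nat_and_no_carries:
  fixes l l' :: nat
  defines "z \<equiv> and l l'"
  shows "z \<le> l" "z \<le> l'" "carries (l - z) (l' - z) = 0" "carries (l + l' - 2 * z) z = 0"
proof -
  define u w where "u = xor l z" and "w = xor l' z"
  have "z + u = or z u" "z + w = or z w"
    by (rule disjunctive_add_eq_or; auto simp: z_def u_def w_def bit_eq_iff bit_simps)+
  moreover have "or z u = l" "or z w = l'"
    by (auto simp: z_def u_def w_def bit_eq_iff bit_simps)
  ultimately have l: "l = z + u" "l' = z + w" by simp_all
  then show "z \<le> l" "z \<le> l'" by simp_all
  have uw: "and u w = 0" by (auto simp: z_def u_def w_def bit_eq_iff bit_simps)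
  then show "carries (l - z) (l' - z) = 0" by (simp add: l carries_eq_0_iff)
  have "l + l' - 2 * z = u + w" by (simp add: l)
  also have "\<dots> = or u w" using uw by (rule disjunctive_add_eq_or)
  finally have "l + l' - 2 * z = or u w" .
  moreover have "and (or u w) z = 0"
    by (auto simp: z_def u_def w_def bit_eq_iff bit_simps)
  ultimately show "carries (l + l' - 2 * z) z = 0" by (simp add: carries_eq_0_iff)
qed

text \<open>If only one summand had the digit at position \<open>a\<close>, the overflow would need
  a carry arriving from below, which makes at least two carries.\<close>

lemma single_carry:
  assumes "y\<^sub>1 < 2 ^ Suc a" "y\<^sub>2 < 2 ^ Suc a" "2 ^ Suc a \<le> y\<^sub>1 + y\<^sub>2" "carries y\<^sub>1 y\<^sub>2 = 1"
  shows "2 ^ a \<le> y\<^sub>1 \<and> 2 ^ a \<le> y\<^sub>2 \<and> carries (y\<^sub>1 - 2 ^ a) (y\<^sub>2 - 2 ^ a) = 0"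
proof -
  have shift: "bitsum (2 ^ a + z) = Suc (bitsum z)" if "z < 2 ^ a" for z
    using bitsum_mult_power2_add [OF that, of 1] by simp
  have shift2: "bitsum (2 ^ Suc a + z) = Suc (bitsum z)" if "z < 2 ^ Suc a" for z
    using bitsum_mult_power2_add [OF that, of 1] by simp
  have no: False if zy: "z < 2 ^ a" "y < 2 ^ a" "2 ^ a \<le> z + y" "carries (2 ^ a + z) y = 1" for z y
  proof -
    obtain w where w: "z + y = 2 ^ a + w" using zy(3) le_Suc_ex by blast
    then have "w < 2 ^ a" using zy by simp
    then have "bitsum (z + y) = Suc (bitsum w)" using w shift by simp
    moreover have sum: "2 ^ a + z + y = 2 ^ Suc a + w" using w by simp
    have "bitsum (2 ^ a + z + y) = Suc (bitsum w)"
      unfolding sum using \<open>w < 2 ^ a\<close> by (intro shift2) simp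
    ultimately have "carries (2 ^ a + z) y = 1 + carries z y"
      using shift [of z] zy by (simp add: carries_def)
    moreover have "carries z y \<ge> 1" using carries_ge_1 [of z a y 0 0] zy by simp
    ultimately show False using zy by simp
  qed
  have ge: "2 ^ a \<le> y\<^sub>1"
  proof (rule ccontr)
    assume "\<not> ?thesis"
    moreover obtain z where "y\<^sub>2 = 2 ^ a + z"
      using assms calculation le_Suc_ex [of "2 ^ a" y\<^sub>2] by auto
    ultimately show False using no [of z y\<^sub>1] assms carries_commute [of y\<^sub>1 y\<^sub>2] by simp
  qed
  have ge': "2 ^ a \<le> y\<^sub>2"
  proof (rule ccontr)
    assume "\<not> ?thesis"
    moreover obtain z where "y\<^sub>1 = 2 ^ a + z"
      using assms calculation le_Suc_ex [of "2 ^ a" y\<^sub>1] by auto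
    ultimately show False using no [of z y\<^sub>2] assms by simp
  qed
  obtain z\<^sub>1 z\<^sub>2 where z: "y\<^sub>1 = 2 ^ a + z\<^sub>1" "y\<^sub>2 = 2 ^ a + z\<^sub>2" using ge ge' le_Suc_ex by metis
  then have less: "z\<^sub>1 < 2 ^ a" "z\<^sub>2 < 2 ^ a" using assms by simp_all
  have "y\<^sub>1 + y\<^sub>2 = 2 ^ Suc a + (z\<^sub>1 + z\<^sub>2)" using z by simp
  then have "bitsum (y\<^sub>1 + y\<^sub>2) = Suc (bitsum (z\<^sub>1 + z\<^sub>2))" using shift2 [of "z\<^sub>1 + z\<^sub>2"] less by simp
  then have "carries y\<^sub>1 y\<^sub>2 = 1 + carries z\<^sub>1 z\<^sub>2"
    using shift [of z\<^sub>1] shift [of z\<^sub>2] less z by (simp add: carries_def)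
  then show ?thesis using ge ge' assms z by simp
qed

text \<open>
  The index \<open>2 ^ e\<close> with \<open>e\<close> the multiplicity of 2 in \<open>x * (x + 1)\<close> is admissible and has weight
  less than \<open>2 ^ a\<close>. The minimizer is unique because the weights of the indices from 1
  to \<open>2 ^ a\<close> are distinct modulo \<open>2 ^ a\<close>.
\<close>

lemma low_index_minimizer:
  fixes a x :: nat
  assumes x: "x < 2 ^ a" and a: "a \<ge> 1"
  defines "adm \<equiv> \<lambda>H j. 1 \<le> H * 2 ^ Suc a + j \<and> j \<le> x + 1 \<and>
    carries (2 * (H * 2 ^ Suc a + j) - 2) (x + 1 - j) = 0"
  defines "wt \<equiv> \<lambda>j. 2 ^ a * int (bitsum j) - int j"
  obtains j\<^sub>0 where "wt j\<^sub>0 < 2 ^ a"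
    and "\<And>H. x \<ge> 1 \<or> H \<ge> 1 \<Longrightarrow> adm H j\<^sub>0"
    and "\<And>H j. adm H j \<Longrightarrow> j \<noteq> j\<^sub>0 \<Longrightarrow> wt j\<^sub>0 < wt j"
proof (cases "x = 0")
  case True
  have "adm H 0" if "H \<ge> 1" for H
  proof -
    have "2 * (H * 2 ^ Suc a) - 2 = 2 * (H * 2 ^ Suc a - 1)" by simp
    then have "even (2 * (H * 2 ^ Suc a) - 2)" by simp
    then have "and (2 * (H * 2 ^ Suc a) - 2) 1 = 0" by (simp add: and_one_eq)
    then show ?thesis using that True by (simp add: adm_def carries_eq_0_iff)
  qed
  moreover have "wt 0 < wt j" if "adm H j" "j \<noteq> 0" for H j
  proof -
    have "j = 1" using that True by (simp add: adm_def)
    \<comment> \<open>Here \<open>a \<ge> 1\<close> matters: for \<open>a = 0\<close> the indices 0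
      and 1 would have equal weight.\<close>
    moreover have "(2::int) ^ a > 1" using a by simp
    ultimately show ?thesis by (simp add: wt_def)
  qed
  ultimately show ?thesis using that [of 0] True by (simp add: wt_def)
next
  case False
  have two: "2 * (2::nat) ^ a = 2 ^ Suc a" by simp
  \<comment> \<open>For \<open>j \<ge> 1\<close> subtracting 2 does not borrow from the high block,
    so \<open>H\<close> has no influence.\<close>
  have indep: "adm H j \<longleftrightarrow> adm 0 j" if "j \<ge> 1" for H j
  proof (cases "j \<le> x + 1")
    case True
    have lt: "2 * j - 2 < 2 ^ Suc a" "x + 1 - j < 2 ^ Suc a" "2 * j - 2 + (x + 1 - j) < 2 ^ Suc a"
      using True that x unfolding two [symmetric] by linarith+
    have "2 * (H * 2 ^ Suc a + j) - 2 = (2 * H) * 2 ^ Suc a + (2 * j - 2)" using that by simp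
    then have "carries (2 * (H * 2 ^ Suc a + j) - 2) (x + 1 - j) = carries (2 * j - 2) (x + 1 - j)"
      using carries_split [OF lt, of "2 * H" 0] by simp
    then show ?thesis using that by (simp add: adm_def)
  next
    case False
    then show ?thesis by (simp add: adm_def)
  qed
  \<comment> \<open>For \<open>j = 0\<close> subtracting 2 borrows from the high block and leaves
    the low block \<open>2 ^ Suc a - 2\<close>, which overflows when \<open>x + 1 \<ge> 2\<close> is
    added.\<close>
  have pos: "j \<ge> 1" if "adm H j" for H j
  proof (rule ccontr)
    assume "\<not> ?thesis"
    then have j: "j = 0" by simp
    then have "H \<ge> 1" using that by (simp add: adm_def)
    have Q: "(2::nat) ^ Suc a \<ge> 2" by simp
    have "2 * (H * 2 ^ Suc a) = (2 * H - 1) * 2 ^ Suc a + 2 ^ Suc a"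
      using \<open>H \<ge> 1\<close> by (cases H) simp_all
    then have "2 * (H * 2 ^ Suc a) - 2 = (2 * H - 1) * 2 ^ Suc a + (2 ^ Suc a - 2)"
      using Q by linarith
    moreover have "carries ((2 * H - 1) * 2 ^ Suc a + (2 ^ Suc a - 2)) (0 * 2 ^ Suc a + (x + 1)) \<ge> 1"
    proof (rule carries_ge_1)
      show "2 ^ Suc a - 2 < (2::nat) ^ Suc a" "x + 1 < 2 ^ Suc a" "2 ^ Suc a \<le> 2 ^ Suc a - 2 + (x + 1)"
        using False x Q unfolding two [symmetric] by linarith+
    qed
    ultimately show False using that j by (simp add: adm_def)
  qed
  define S where "S = {j. adm 0 j}"
  have fin: "finite S" by (rule finite_subset [of _ "{..x + 1}"]) (auto simp: S_def adm_def)
  obtain e where e: "e \<le> a" "2 ^ e \<in> S"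
  proof -
    \<comment> \<open>The even one of \<open>x\<close> and \<open>x + 1\<close>. Writing it as
      \<open>2 ^ Suc e * u + 2 ^ e\<close> shows that below position \<open>Suc e\<close> the number
      \<open>x + 1 - 2 ^ e\<close> has at most its last digit \<open>i\<close>, whereas
      \<open>2 * 2 ^ e - 2\<close> is even and lies below \<open>2 ^ Suc e\<close>.\<close>
    define y where "y = (if even x then x else x + 1)"
    define e where "e = multiplicity 2 y"
    have "y \<noteq> 0" using False by (simp add: y_def)
    then obtain c where "y = 2 ^ multiplicity 2 y * c" "odd c"
      using multiplicity_decompose' [of y 2] by (metis odd_one)
    then have c: "y = 2 ^ e * c" "odd c" unfolding e_def .
    then obtain u where u: "c = 2 * u + 1" by (blast elim: oddE)
    have y: "y = 2 ^ Suc e * u + 2 ^ e" using c u by (simp add: algebra_simps)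
    have yx: "y \<le> x + 1" by (simp add: y_def)
    have le: "2 ^ e \<le> x + 1" using y yx by simp
    have "2 ^ e \<le> (2::nat) ^ a"
      using le x by linarith
    then have ea: "e \<le> a" by simp
    obtain i where i: "x + 1 - 2 ^ e = 2 ^ Suc e * u + i" "i \<le> 1" "i = 0 \<or> even x"
      using y False by (cases "even x") (auto simp: y_def)
    have "e \<ge> 1"
    proof (rule ccontr)
      assume "\<not> e \<ge> 1"
      then have "odd y" using y by simp
      then show False by (simp add: y_def split: if_splits)
    qed
    have e1: "(1::nat) \<le> 2 ^ e" by simp
    then have "2 * 2 ^ e - 2 + i < (2::nat) ^ Suc e" using i(2) unfolding power_Suc by arith
    moreover have "i < 2 ^ Suc e" using i(2) e1 unfolding power_Suc by linarith
    moreover have ee: "2 * 2 ^ e - 2 < (2::nat) ^ Suc e" by simp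
    ultimately have "carries (0 * 2 ^ Suc e + (2 * 2 ^ e - 2)) (u * 2 ^ Suc e + i)
        = carries (2 * 2 ^ e - 2) i"
      by (subst carries_split) (auto simp: carries_def)
    moreover have "carries (2 * 2 ^ e - 2) i = 0"
    proof -
      have "2 * 2 ^ e - 2 = 2 * (2 ^ e - 1 :: nat)" by simp
      then have "even (2 * 2 ^ e - 2 :: nat)" by simp
      then have "and (2 * 2 ^ e - 2) i = 0"
        using i(2) by (cases "i = 0") (auto simp: and_one_eq le_Suc_eq)
      then show ?thesis by (simp add: carries_eq_0_iff)
    qed
    ultimately have "2 ^ e \<in> S" using i le by (simp add: S_def adm_def mult.commute)
    then show ?thesis using that ea by blast
  qed
  define j\<^sub>0 where "j\<^sub>0 = arg_min_on wt S"
  have min: "j\<^sub>0 \<in> S" "\<And>j. j \<in> S \<Longrightarrow> wt j\<^sub>0 \<le> wt j"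
    using arg_min_if_finite [of S wt] fin e(2) arg_min_least [of S _ wt] unfolding j\<^sub>0_def by auto
  have "wt j\<^sub>0 \<le> 2 ^ a - 2 ^ e" using min(2) [OF e(2)] by (simp add: wt_def)
  then have small: "wt j\<^sub>0 < 2 ^ a"
    by (rule le_less_trans) simp
  have strict: "wt j\<^sub>0 < wt j" if "j \<in> S" "j \<noteq> j\<^sub>0" for j
  proof (rule ccontr)
    assume "\<not> ?thesis"
    then have "wt j = wt j\<^sub>0" using min(2) that by force
    then have eq: "int j - int j\<^sub>0 = 2 ^ a * (int (bitsum j) - int (bitsum j\<^sub>0))"
      by (simp add: wt_def algebra_simps)
    have "\<bar>int j - int j\<^sub>0\<bar> < 2 ^ a"
    proof -
      have "1 \<le> j" "j \<le> 2 ^ a" "1 \<le> j\<^sub>0" "j\<^sub>0 \<le> 2 ^ a"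
        using that(1) min(1) pos [of 0] x by (auto simp: S_def adm_def)
      then have "1 \<le> int j" "int j \<le> int (2 ^ a)" "1 \<le> int j\<^sub>0" "int j\<^sub>0 \<le> int (2 ^ a)"
        unfolding of_nat_le_iff by simp_all
      then have "\<bar>int j - int j\<^sub>0\<bar> < int (2 ^ a)" by linarith
      then show ?thesis by simp
    qed
    then have "int j - int j\<^sub>0 = 0"
      using eq dvd_imp_le_int [of "int j - int j\<^sub>0" "2 ^ a"] by fastforce
    then show False using that by simp
  qed
  show ?thesis
  proof (rule that)
    show "wt j\<^sub>0 < 2 ^ a" by (rule small)
    show "adm H j\<^sub>0" for H using min(1) pos [of 0 j\<^sub>0] indep [of j\<^sub>0 H] by (simp add: S_def)
    show "wt j\<^sub>0 < wt j" if "adm H j" "j \<noteq> j\<^sub>0" for H j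
      using that pos [of H j] indep [of j H] strict by (simp add: S_def)
  qed
qed

section \<open>Two terms of minimal weight\<close>

text \<open>
  Two numbers \<open>n\<close> and \<open>m\<close> with a common binary digit 1 at position \<open>a\<close>; \<open>h\<close>, \<open>h'\<close> collect the
  higher and \<open>l\<close>, \<open>l'\<close> the lower digits.
\<close>

locale common_bit =
  fixes a h h' l l' :: nat
  assumes a: "a \<ge> 1" and l: "l < 2 ^ a" and l': "l' < 2 ^ a"
begin

definition "n = h * 2 ^ Suc a + 2 ^ a + l"
definition "m = h' * 2 ^ Suc a + 2 ^ a + l'"
definition "z = and l l'"
text \<open>Bitwise the exclusive or of \<open>l\<close> and \<open>l'\<close>. It is the low block
  of \<open>n + m - 2 * r\<close> for both minimizing values of \<open>r\<close>.\<close>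

definition "x = l + l' - 2 * z"

text \<open>By Legendre's formula this is the valuation of \<open>fact (2 * j)\<close>. It is
  strictly increasing and so penalizes a high block below its maximum.\<close>

definition G :: "nat \<Rightarrow> int" where "G j = 2 * int j - int (bitsum j)"

text \<open>
  In the primitive of \<open>p\<^sub>m p\<^sub>n\<close>, the \<open>r\<close>-th summand of Adams' formula contributes to \<open>t ^ k\<close> a term of
  valuation \<open>cost r k - 1\<close>. Up to a constant, the weight \<open>2 ^ a * cost r k - k\<close> is the sum
  of \<open>2 ^ a * excess r k\<close> and \<open>2 ^ a * bitsum j - j\<close> with \<open>j = k mod 2 ^ Suc a\<close>, both nonnegative.
\<close>

definition cost :: "nat \<Rightarrow> nat \<Rightarrow> int" where
  "cost r k = carries (n - r) (m - r) + carries (n + m - 2 * r) r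
     + carries (2 * k - 2) (n + m - 2 * r + 1 - k) + int (bitsum k)"

definition excess :: "nat \<Rightarrow> nat \<Rightarrow> int" where
  "excess r k = cost r k + G h + G h' - 2 * int (k div 2 ^ Suc a) - int (bitsum (k mod 2 ^ Suc a))"

text \<open>The range of \<open>k\<close> is that of the exponents of a polynomial of degree
  \<open>n + m - 2 * r\<close>, shifted by one through integration.\<close>

definition valid :: "nat \<Rightarrow> nat \<Rightarrow> bool" where
  "valid r k \<longleftrightarrow> r \<le> n \<and> r \<le> m \<and> 1 \<le> k \<and> k \<le> n + m - 2 * r + 1"

lemma G_less: "i < j \<Longrightarrow> G i + 1 \<le> G j"
  using double_minus_bitsum_less [of i j] by (simp add: G_def)

lemma G_mono: "i \<le> j \<Longrightarrow> G i \<le> G j"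
  using G_less [of i j] by (cases "i = j") auto

lemma bitsum_div_mod: "bitsum j = bitsum (j div 2 ^ i) + bitsum (j mod 2 ^ i)"
proof -
  have "j mod 2 ^ i < 2 ^ i" by simp
  from bitsum_mult_power2_add [OF this, of "j div 2 ^ i"]
  show ?thesis by (simp only: div_mult_mod_eq)
qed

lemma x_props: "z \<le> l" "z \<le> l'" "carries (l - z) (l' - z) = 0" "carries x z = 0" "x < 2 ^ a"
proof -
  show zl: "z \<le> l" "z \<le> l'" "carries (l - z) (l' - z) = 0" "carries x z = 0"
    unfolding x_def z_def by (rule nat_and_no_carries)+
  have "x = (l - z) + (l' - z)" using zl by (simp add: x_def)
  then show "x < 2 ^ a" using carries_0_add_less [OF zl(3), of a] l l' by simp
qed

text \<open>Subtracting \<open>r\<close> leaves the high block intact as long as the low block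
  \<open>2 ^ a + l\<close> suffices to pay for it.\<close>

lemma high_part_le:
  assumes "r \<le> n"
  shows "(n - r) div 2 ^ Suc a \<le> h"
    and "(n - r) div 2 ^ Suc a = h \<longleftrightarrow> r \<le> 2 ^ a + l"
    and "r \<le> 2 ^ a + l \<Longrightarrow> (n - r) mod 2 ^ Suc a = 2 ^ a + l - r"
proof -
  have lt: "2 ^ a + l < 2 ^ Suc a" using l by simp
  have n: "n = h * 2 ^ Suc a + (2 ^ a + l)" by (simp add: n_def)
  have "n div 2 ^ Suc a = h" using lt unfolding n by simp
  then show le: "(n - r) div 2 ^ Suc a \<le> h" by (metis div_le_mono diff_le_self)
  show mod: "(n - r) mod 2 ^ Suc a = 2 ^ a + l - r" if "r \<le> 2 ^ a + l"
  proof -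
    have "n - r = h * 2 ^ Suc a + (2 ^ a + l - r)" using that by (simp add: n)
    moreover have "2 ^ a + l - r < 2 ^ Suc a" using lt by simp
    ultimately show ?thesis by simp
  qed
  show "(n - r) div 2 ^ Suc a = h \<longleftrightarrow> r \<le> 2 ^ a + l"
  proof
    assume "r \<le> 2 ^ a + l"
    then have "n - r = h * 2 ^ Suc a + (2 ^ a + l - r)" by (simp add: n)
    moreover have "2 ^ a + l - r < 2 ^ Suc a" using lt by simp
    ultimately show "(n - r) div 2 ^ Suc a = h" by simp
  next
    assume "(n - r) div 2 ^ Suc a = h"
    then have "h * 2 ^ Suc a \<le> n - r" by (metis div_times_less_eq_dividend)
    then show "r \<le> 2 ^ a + l" using assms unfolding n by linarith
  qed
qed

end

text \<open>The assumptions are symmetric in the two numbers; the swapped copy supplies the facts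
  about \<open>m\<close>.\<close>

sublocale common_bit \<subseteq> swap: common_bit a h' h l' l
  by unfold_locales (rule a l l')+

context common_bit
begin

lemma swap_n: "swap.n = m"
  by (simp add: swap.n_def m_def)

lemmas high_part_le' = swap.high_part_le [unfolded swap_n]

definition carry_out :: "nat \<Rightarrow> nat" where
  "carry_out r = ((n - r) mod 2 ^ Suc a + (m - r) mod 2 ^ Suc a) div 2 ^ Suc a"

text \<open>All numbers are split at position \<open>Suc a\<close>. In the resulting sum every
  summand is nonnegative except possibly the difference of \<open>G\<close> at the high blocks of
  \<open>n + m - 2 * r\<close> and \<open>k\<close>, which \<open>excess_top\<close> treats.\<close>

lemma excess_eq:
  assumes "r \<le> n" "r \<le> m"
  shows
    "(n + m - 2 * r) div 2 ^ Suc a = (n - r) div 2 ^ Suc a + (m - r) div 2 ^ Suc a + carry_out r"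
    "(n - r) mod 2 ^ Suc a + (m - r) mod 2 ^ Suc a
       = carry_out r * 2 ^ Suc a + (n + m - 2 * r) mod 2 ^ Suc a"
    "carry_out r = 0 \<or> carry_out r = 1"
    "int (carry_out r) \<le> carries ((n - r) mod 2 ^ Suc a) ((m - r) mod 2 ^ Suc a)"
    "excess r k = (G h - G ((n - r) div 2 ^ Suc a)) + (G h' - G ((m - r) div 2 ^ Suc a))
       + (G ((n + m - 2 * r) div 2 ^ Suc a) - G (k div 2 ^ Suc a))
       + (carries ((n - r) mod 2 ^ Suc a) ((m - r) mod 2 ^ Suc a) - int (carry_out r))
       + carries (n + m - 2 * r) r + carries (2 * k - 2) (n + m - 2 * r + 1 - k)"
proof -
  define Q :: nat where "Q = 2 ^ Suc a"
  have Q: "Q > 0" by (simp add: Q_def)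
  define h\<^sub>1 h\<^sub>2 y\<^sub>1 y\<^sub>2 where "h\<^sub>1 = (n - r) div Q" and "h\<^sub>2 = (m - r) div Q"
    and "y\<^sub>1 = (n - r) mod Q" and "y\<^sub>2 = (m - r) mod Q"
  define H K where "H = (n + m - 2 * r) div Q" and "K = (n + m - 2 * r) mod Q"
  define c where "c = (y\<^sub>1 + y\<^sub>2) div Q"
  have y: "y\<^sub>1 < Q" "y\<^sub>2 < Q" using Q by (simp_all add: y\<^sub>1_def y\<^sub>2_def)
  have sum: "n + m - 2 * r = (n - r) + (m - r)" using assms by simp
  have H: "H = h\<^sub>1 + h\<^sub>2 + c"
    unfolding H_def sum h\<^sub>1_def h\<^sub>2_def c_def y\<^sub>1_def y\<^sub>2_def by (rule div_add1_eq)
  have "K = (y\<^sub>1 + y\<^sub>2) mod Q"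
    unfolding K_def sum y\<^sub>1_def y\<^sub>2_def by (simp add: mod_add_eq)
  then have yK: "y\<^sub>1 + y\<^sub>2 = c * Q + K" by (simp add: c_def)
  have c: "c = 0 \<or> c = 1"
  proof -
    have "y\<^sub>1 + y\<^sub>2 < 2 * Q" using y by simp
    then have "c < 2" unfolding c_def by (rule less_mult_imp_div_less)
    then show ?thesis by auto
  qed
  have carry: "int c \<le> carries y\<^sub>1 y\<^sub>2"
  proof (cases "c = 0")
    case True
    then show ?thesis by (simp add: carries_nonneg)
  next
    case False
    then have "c = 1" using c by simp
    then show ?thesis using carries_ge_1 [of y\<^sub>1 "Suc a" y\<^sub>2 0 0] y yK by (simp add: Q_def)
  qed
  have KQ: "K < Q" using Q by (simp add: K_def)
  have s: "bitsum (n - r) = bitsum h\<^sub>1 + bitsum y\<^sub>1" "bitsum (m - r) = bitsum h\<^sub>2 + bitsum y\<^sub>2"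
    "bitsum (n + m - 2 * r) = bitsum H + bitsum K"
    unfolding h\<^sub>1_def h\<^sub>2_def y\<^sub>1_def y\<^sub>2_def H_def K_def Q_def by (rule bitsum_div_mod)+
  have sy: "bitsum (y\<^sub>1 + y\<^sub>2) = c + bitsum K"
    using bitsum_mult_power2_add [OF KQ [unfolded Q_def], of c] c yK by (auto simp: Q_def)
  have *: "excess r k = (G h - G h\<^sub>1) + (G h' - G h\<^sub>2) + (G H - G (k div Q))
       + (carries y\<^sub>1 y\<^sub>2 - int c)
       + carries (n + m - 2 * r) r + carries (2 * k - 2) (n + m - 2 * r + 1 - k)" for k
  proof -
    have "carries (n - r) (m - r) =
        int (bitsum h\<^sub>1) + int (bitsum y\<^sub>1) + int (bitsum h\<^sub>2) + int (bitsum y\<^sub>2) - int (bitsum H) - int (bitsum K)"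
      unfolding carries_def sum [symmetric] s by simp
    moreover have "carries y\<^sub>1 y\<^sub>2 = int (bitsum y\<^sub>1) + int (bitsum y\<^sub>2) - int c - int (bitsum K)"
      unfolding carries_def sy by simp
    moreover have "int (bitsum k) = int (bitsum (k div Q)) + int (bitsum (k mod Q))"
      unfolding Q_def of_nat_add [symmetric] of_nat_eq_iff by (rule bitsum_div_mod)
    moreover have "int H = int h\<^sub>1 + int h\<^sub>2 + int c" using H by simp
    ultimately show ?thesis
      unfolding excess_def cost_def G_def Q_def [symmetric] by linarith
  qed
  have co: "carry_out r = c"
    unfolding carry_out_def c_def y\<^sub>1_def y\<^sub>2_def Q_def ..
  note unf = H_def K_def h\<^sub>1_def h\<^sub>2_def y\<^sub>1_def y\<^sub>2_def Q_def
  show "(n + m - 2 * r) div 2 ^ Suc a = (n - r) div 2 ^ Suc a + (m - r) div 2 ^ Suc a + carry_out r"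
    unfolding co using H [unfolded unf] .
  show "(n - r) mod 2 ^ Suc a + (m - r) mod 2 ^ Suc a
       = carry_out r * 2 ^ Suc a + (n + m - 2 * r) mod 2 ^ Suc a"
    unfolding co using yK [unfolded unf] .
  show "carry_out r = 0 \<or> carry_out r = 1" unfolding co by (rule c)
  show "int (carry_out r) \<le> carries ((n - r) mod 2 ^ Suc a) ((m - r) mod 2 ^ Suc a)"
    unfolding co using carry [unfolded unf] .
  show "excess r k = (G h - G ((n - r) div 2 ^ Suc a)) + (G h' - G ((m - r) div 2 ^ Suc a))
       + (G ((n + m - 2 * r) div 2 ^ Suc a) - G (k div 2 ^ Suc a))
       + (carries ((n - r) mod 2 ^ Suc a) ((m - r) mod 2 ^ Suc a) - int (carry_out r))
       + carries (n + m - 2 * r) r + carries (2 * k - 2) (n + m - 2 * r + 1 - k)"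
    unfolding co using * [of k, unfolded unf] .
qed

section \<open>Nonnegativity and zeros of the excess\<close>

definition adm :: "nat \<Rightarrow> nat \<Rightarrow> bool" where
  "adm H j \<longleftrightarrow> 1 \<le> H * 2 ^ Suc a + j \<and> j \<le> x + 1 \<and>
    carries (2 * (H * 2 ^ Suc a + j) - 2) (x + 1 - j) = 0"

lemma excess_solution:
  assumes "r = z \<and> H = h + h' + 1 \<or> r = z + 2 ^ a \<and> H = h + h'" "adm H j"
  shows "valid r (H * 2 ^ Suc a + j)" "excess r (H * 2 ^ Suc a + j) = 0"
    "(H * 2 ^ Suc a + j) div 2 ^ Suc a = H" "(H * 2 ^ Suc a + j) mod 2 ^ Suc a = j"
proof -
  note xp = x_props
  have xa: "x + 1 \<le> 2 ^ a" using xp(5) by simp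
  have jq: "j < 2 ^ Suc a"
  proof -
    have "j \<le> 2 ^ a" using assms(2) xa by (simp add: adm_def)
    also have "\<dots> < 2 ^ Suc a" by simp
    finally show ?thesis .
  qed
  show dm: "(H * 2 ^ Suc a + j) div 2 ^ Suc a = H" "(H * 2 ^ Suc a + j) mod 2 ^ Suc a = j"
    using jq by simp_all
  have r: "r \<le> 2 ^ a + l" "r \<le> 2 ^ a + l'" using assms(1) xp by auto
  have rn: "r \<le> n" "r \<le> m" using r by (auto simp: n_def m_def)
  have xz: "x + 2 * z = l + l'" using xp by (simp add: x_def)
  have K: "n + m - 2 * r = H * 2 ^ Suc a + x"
  proof -
    have "n + m = (h + h' + 1) * 2 ^ Suc a + x + 2 * z"
      using xz by (simp add: n_def m_def algebra_simps)
    then show ?thesis using assms(1) by (auto simp: algebra_simps)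
  qed
  show "valid r (H * 2 ^ Suc a + j)"
    using rn assms(2) unfolding valid_def K adm_def by simp
  have xQ: "x < 2 ^ Suc a" using xa by (simp add: le_less_trans)
  have div1: "(n - r) div 2 ^ Suc a = h" "(m - r) div 2 ^ Suc a = h'"
    using high_part_le(2) [OF rn(1)] high_part_le'(2) [OF rn(2)] r by auto
  have mod1: "(n - r) mod 2 ^ Suc a = 2 ^ a + l - r" "(m - r) mod 2 ^ Suc a = 2 ^ a + l' - r"
    using high_part_le(3) [OF rn(1) r(1)] high_part_le'(3) [OF rn(2) r(2)] by auto
  have divK: "(n + m - 2 * r) div 2 ^ Suc a = H" using xQ by (simp add: K)
  define c where "c = carry_out r"
  note c = excess_eq(1,5) [OF rn, folded c_def]
  \<comment> \<open>For \<open>r = z\<close> both low blocks contain the digit at position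
    \<open>a\<close>, and this produces the one carry into the high block; for
    \<open>r = z + 2 ^ a\<close> the digit is gone from both.\<close>
  have cc: "carries (2 ^ a + l - r) (2 ^ a + l' - r) = int c"
  proof (cases "r = z")
    case True
    moreover have "H = h + h' + 1" using assms(1) True by auto
    then have "c = 1" using c(1) div1 divK by simp
    moreover have less: "l - z < 2 ^ a" "l' - z < 2 ^ a" "l - z + (l' - z) < 2 ^ Suc a"
      using l l' by auto
    have s1: "bitsum (2 ^ a + (l - z)) = Suc (bitsum (l - z))"
      "bitsum (2 ^ a + (l' - z)) = Suc (bitsum (l' - z))"
      using bitsum_mult_power2_add [OF less(1), of 1] bitsum_mult_power2_add [OF less(2), of 1] by simp_all
    have e: "2 ^ a + (l - z) + (2 ^ a + (l' - z)) = 1 * 2 ^ Suc a + ((l - z) + (l' - z))" by simp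
    have "bitsum (2 ^ a + (l - z) + (2 ^ a + (l' - z))) = Suc (bitsum ((l - z) + (l' - z)))"
      unfolding e bitsum_mult_power2_add [OF less(3)] by simp
    then have "carries (2 ^ a + (l - z)) (2 ^ a + (l' - z)) = 1 + carries (l - z) (l' - z)"
      unfolding carries_def s1 by simp
    ultimately show ?thesis using xp by simp
  next
    case False
    then have "r = z + 2 ^ a" "H = h + h'" using assms(1) by auto
    then show ?thesis using xp c(1) div1 divK by simp
  qed
  \<comment> \<open>The low \<open>a\<close> digits of the two numbers are \<open>x\<close> and
    \<open>z\<close>, which are disjoint, and \<open>n + m - 2 * r\<close> has no digit at position
    \<open>a\<close>, the only further one that \<open>r\<close> may have.\<close>
  have "carries (n + m - 2 * r) r = 0"
  proof -
    obtain i where i: "r = i * 2 ^ a + z" using assms(1) by (metis mult_0 add_0 mult_1 add.commute)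
    have K': "n + m - 2 * r = (2 * H) * 2 ^ a + x" by (simp add: K)
    have less: "x < 2 ^ a" "z < 2 ^ a" "x + z < 2 ^ a"
      using xp l carries_0_add_less [OF xp(4), of a] by auto
    have "i = 0 \<or> i = 1" using i assms(1) less by auto
    then have "carries (2 * H) i = 0" by (auto simp: carries_eq_0_iff and_one_eq)
    then show ?thesis unfolding K' unfolding i carries_split [OF less] using xp by simp
  qed
  moreover have "carries (2 * (H * 2 ^ Suc a + j) - 2) (n + m - 2 * r + 1 - (H * 2 ^ Suc a + j)) = 0"
  proof -
    have "n + m - 2 * r + 1 - (H * 2 ^ Suc a + j) = x + 1 - j" by (simp add: K)
    then show ?thesis using assms(2) by (simp only: adm_def)
  qed
  ultimately show "excess r (H * 2 ^ Suc a + j) = 0"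
    unfolding c(2) div1 mod1 divK dm cc by simp
qed

text \<open>The negative summand occurs only if \<open>k = K + 1\<close> is a multiple of
  \<open>2 ^ Suc a\<close>, where \<open>K = n + m - 2 * r\<close>. Then \<open>K\<close> ends in
  \<open>Suc a\<close> ones, and adding \<open>r\<close> to it causes enough carries to
  compensate.\<close>

lemma excess_top:
  assumes v: "valid r k" and top: "(n + m - 2 * r) div 2 ^ Suc a < k div 2 ^ Suc a"
  shows "excess r k \<ge> 1"
proof -
  define Q :: nat where "Q = 2 ^ Suc a"
  have Q: "Q > 0" by (simp add: Q_def)
  have rn: "r \<le> n" "r \<le> m" using v by (auto simp: valid_def)
  define K H where "K = n + m - 2 * r" and "H = K div Q"
  have "k \<le> K + 1" using v by (simp add: valid_def K_def)
  have "Suc H \<le> k div Q" using top by (simp add: H_def K_def Q_def)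
  then have "Suc H * Q \<le> k" using Q by (simp add: less_eq_div_iff_mult_less_eq)
  moreover have "K < Suc H * Q" using Q unfolding H_def by (simp add: dividend_less_div_times)
  ultimately have k: "k = Suc H * Q" "K + 1 = Suc H * Q" using \<open>k \<le> K + 1\<close> by linarith+
  have KH: "K = H * Q + (Q - 1)" using k Q by simp
  have kdiv: "k div Q = Suc H" using k Q by simp
  define c where "c = carry_out r"
  note c = excess_eq(4,5) [OF rn, folded c_def Q_def K_def, folded H_def]
  define \<rho> r\<^sub>0 where "\<rho> = r div Q" and "r\<^sub>0 = r mod Q"
  have r: "r = \<rho> * Q + r\<^sub>0" by (simp add: \<rho>_def r\<^sub>0_def)
  have r0Q: "r\<^sub>0 < Q" using Q by (simp add: r\<^sub>0_def)
  have KmodQ: "K mod Q = Q - 1"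
    unfolding KH mod_mult_self3 using Q by simp
  \<comment> \<open>So \<open>l + l'\<close> is not the residue \<open>Q - 1\<close> of
    \<open>K\<close>. This rules out the multiples \<open>r\<close> of \<open>Q\<close>, and later
    \<open>r = 2 ^ a\<close>: for these, \<open>K\<close> is congruent to \<open>l + l'\<close>
    modulo \<open>Q\<close>.\<close>
  have parity: "l + l' + 1 < Q" using l l' by (simp add: Q_def)
  have "r\<^sub>0 \<noteq> 0"
  proof
    assume "r\<^sub>0 = 0"
    then have "K + 2 * \<rho> * Q = (h + h' + 1) * Q + (l + l')"
      using rn r unfolding K_def n_def m_def Q_def by (simp add: add_mult_distrib)
    then have "(K + 2 * \<rho> * Q) mod Q = (l + l') mod Q" by (simp only: mod_mult_self3)
    then show False using KmodQ parity by simp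
  qed
  then have r0: "r\<^sub>0 \<ge> 1" by simp
  have sK: "bitsum K = bitsum H + Suc a"
  proof -
    show ?thesis
      using bitsum_mult_power2_add [of "Q - 1" "Suc a" H] bitsum_mask [of "Suc a"] Q
      unfolding KH Q_def by simp
  qed
  have sr: "bitsum r = bitsum \<rho> + bitsum r\<^sub>0"
    using bitsum_mult_power2_add [of r\<^sub>0 "Suc a" \<rho>] r0Q r by (simp add: Q_def)
  have "K + r = (Suc H + \<rho>) * Q + (r\<^sub>0 - 1)"
    using r0 Q unfolding KH r by (simp add: algebra_simps)
  then have sKr: "bitsum (K + r) = bitsum (Suc H + \<rho>) + bitsum (r\<^sub>0 - 1)"
    using bitsum_mult_power2_add [of "r\<^sub>0 - 1" "Suc a" "Suc H + \<rho>"] r0Q by (simp add: Q_def)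
  have sa: "bitsum (Suc H + \<rho>) \<le> bitsum (Suc H) + bitsum \<rho>" by (rule bitsum_add_le)
  have main: "G H - G (Suc H) + carries K r \<ge> int a - 1 + int (bitsum r\<^sub>0) - int (bitsum (r\<^sub>0 - 1))"
    using sK sr sKr sa unfolding carries_def G_def by simp
  have others: "G h - G ((n - r) div Q) \<ge> 0" "G h' - G ((m - r) div Q) \<ge> 0"
    "carries (2 * k - 2) (K + 1 - k) \<ge> 0"
    using high_part_le(1) [OF rn(1)] high_part_le'(1) [OF rn(2)]
    by (auto simp: Q_def G_mono carries_nonneg simp del: power_Suc)
  have r0le: "bitsum (r\<^sub>0 - 1) \<le> a"
  proof (rule ccontr)
    assume gt: "\<not> ?thesis"
    have "r\<^sub>0 - 1 < Q - 1" using r0 r0Q by simp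
    have "r\<^sub>0 - 1 = 2 ^ Suc a - 1"
      using gt r0Q r0 by (intro eq_mask_if_bitsum_ge) (auto simp: Q_def)
    then show False using \<open>r\<^sub>0 - 1 < Q - 1\<close> by (simp add: Q_def)
  qed
  have sr0: "bitsum r\<^sub>0 \<ge> 1" using bitsum_pos [of r\<^sub>0] r0 by simp
  show ?thesis
  proof (rule ccontr)
    assume "\<not> ?thesis"
    then have "excess r k \<le> 0" by simp
    then have zero: "G h - G ((n - r) div Q) = 0" "G h' - G ((m - r) div Q) = 0"
      "bitsum (r\<^sub>0 - 1) = a" "bitsum r\<^sub>0 = 1"
      using c(2) [of k] c(1) main others r0le sr0 unfolding kdiv by linarith+
    have high: "(n - r) div Q = h" "(m - r) div Q = h'"
      using zero(1,2) G_less high_part_le(1) [OF rn(1)] high_part_le'(1) [OF rn(2)]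
      unfolding Q_def by (metis add_le_same_cancel1 diff_eq_eq add_0 le_neq_implies_less not_one_le_zero)+
    have rl: "r \<le> 2 ^ a + l" "r \<le> 2 ^ a + l'"
      using high high_part_le(2) [OF rn(1)] high_part_le'(2) [OF rn(2)] by (auto simp: Q_def)
    have "r < Q" using rl l by (simp add: Q_def)
    then have "r = r\<^sub>0" by (simp add: r\<^sub>0_def)
    \<comment> \<open>Equality in all estimates makes \<open>r\<close> divisible by
      \<open>2 ^ a\<close>; as \<open>0 < r < 2 * 2 ^ a\<close>, only \<open>r = 2 ^ a\<close> is
      left.\<close>
    have "val2 (of_nat r) = int a"
      using bitsum_Suc [of "r\<^sub>0 - 1"] zero r0 \<open>r = r\<^sub>0\<close> by simp
    then have "multiplicity 2 (int r) = a"
      using val2_of_int [of "int r"] r0 \<open>r = r\<^sub>0\<close> by simp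
    then have "(2::int) ^ a dvd int r" by (metis multiplicity_dvd)
    then have "2 ^ a dvd r" by (simp flip: of_nat_dvd_iff [where 'a = int])
    then obtain i where i: "r = 2 ^ a * i" by blast
    have "i < 2" using \<open>r < Q\<close> i by (simp add: Q_def)
    then have ra: "r = 2 ^ a" using i r0 \<open>r = r\<^sub>0\<close> by (cases "i = 0") (auto simp: numeral_2_eq_2 less_Suc_eq)
    have "K = (h + h') * Q + (l + l')"
      unfolding K_def ra n_def m_def Q_def by (simp add: algebra_simps)
    then have "K mod Q = l + l'" using parity by simp
    then show False using KmodQ parity by simp
  qed
qed

lemma excess_nonneg:
  assumes v: "valid r k"
  shows "excess r k \<ge> 0"
proof (cases "(n + m - 2 * r) div 2 ^ Suc a < k div 2 ^ Suc a")
  case True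
  then show ?thesis using excess_top [OF v] by simp
next
  case False
  then have "G (k div 2 ^ Suc a) \<le> G ((n + m - 2 * r) div 2 ^ Suc a)" by (simp add: G_mono)
  moreover have rn: "r \<le> n" "r \<le> m" using v by (auto simp: valid_def)
  moreover have "G ((n - r) div 2 ^ Suc a) \<le> G h" "G ((m - r) div 2 ^ Suc a) \<le> G h'"
    using high_part_le(1) [OF rn(1)] high_part_le'(1) [OF rn(2)] by (simp_all only: G_mono)
  moreover note excess_eq(4) [OF rn] excess_eq(5) [OF rn, of k]
  ultimately show ?thesis
    using carries_nonneg [of "n + m - 2 * r" r] carries_nonneg [of "2 * k - 2" "n + m - 2 * r + 1 - k"]
    by simp
qed

text \<open>All summands of \<open>excess_eq\<close> must vanish. Strict monotonicity of
  \<open>G\<close> fixes the high blocks, the carry conditions lead to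
  \<open>nat_eq_and_if_no_carries\<close>, and \<open>carry_out r\<close> decides between the two
  solutions.\<close>

lemma excess_eq_0:
  assumes v: "valid r k" and zero: "excess r k = 0"
  shows "(r = z \<and> k div 2 ^ Suc a = h + h' + 1 \<or> r = z + 2 ^ a \<and> k div 2 ^ Suc a = h + h')
    \<and> adm (k div 2 ^ Suc a) (k mod 2 ^ Suc a)"
proof -
  define Q :: nat where "Q = 2 ^ Suc a"
  have rn: "r \<le> n" "r \<le> m" using v by (auto simp: valid_def)
  define K where "K = n + m - 2 * r"
  define c where "c = carry_out r"
  note c = excess_eq [OF rn, folded c_def Q_def K_def]
  have kK: "k div Q \<le> K div Q"
    using excess_top [OF v] zero unfolding Q_def K_def by force
  have nn: "G h - G ((n - r) div Q) \<ge> 0" "G h' - G ((m - r) div Q) \<ge> 0" "G (K div Q) - G (k div Q) \<ge> 0"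
    using high_part_le(1) [OF rn(1)] high_part_le'(1) [OF rn(2)] kK
    by (auto simp: Q_def G_mono simp del: power_Suc)
  have "carries K r \<ge> 0" "carries (2 * k - 2) (K + 1 - k) \<ge> 0" by (rule carries_nonneg)+
  then have eqs: "G h = G ((n - r) div Q)" "G h' = G ((m - r) div Q)" "G (K div Q) = G (k div Q)"
    "carries ((n - r) mod Q) ((m - r) mod Q) = int c" "carries K r = 0"
    "carries (2 * k - 2) (K + 1 - k) = 0"
    using c(5) [of k] c(4) nn zero by linarith+
  have G_inj: "i = j" if "G i = G j" for i j
    using G_less [of i j] G_less [of j i] that by (cases i j rule: linorder_cases) auto
  have high: "(n - r) div Q = h" "(m - r) div Q = h'" "k div Q = K div Q"
    using eqs G_inj by metis+
  have rl: "r \<le> 2 ^ a + l" "r \<le> 2 ^ a + l'"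
    using high high_part_le(2) [OF rn(1)] high_part_le'(2) [OF rn(2)] by (auto simp: Q_def)
  have mods: "(n - r) mod Q = 2 ^ a + l - r" "(m - r) mod Q = 2 ^ a + l' - r"
    using high_part_le(3) [OF rn(1) rl(1)] high_part_le'(3) [OF rn(2) rl(2)] by (auto simp: Q_def)
  have KQ: "K = K div Q * Q + K mod Q" by simp
  have rQ: "r < Q" using rl l by (simp add: Q_def)
  have "and K r = 0" using eqs(5) by (simp add: carries_eq_0_iff)
  have low: "carries (K mod Q) r = 0"
  proof -
    have "take_bit (Suc a) (and K r) = 0" using \<open>and K r = 0\<close> by simp
    then have "and (take_bit (Suc a) K) (take_bit (Suc a) r) = 0" by (simp only: take_bit_and)
    moreover have "take_bit (Suc a) r = r" using rQ by (simp add: take_bit_eq_mod Q_def)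
    moreover have "take_bit (Suc a) K = K mod Q" by (simp add: take_bit_eq_mod Q_def)
    ultimately show ?thesis by (simp add: carries_eq_0_iff)
  qed
  have sol: "r = z \<and> K div Q = h + h' + 1 \<or> r = z + 2 ^ a \<and> K div Q = h + h'"
  proof (cases "c = 1")
    case True
    have "2 ^ Suc a \<le> 2 ^ a + l - r + (2 ^ a + l' - r)"
      using c(2) True unfolding mods unfolding Q_def by simp
    then have sc: "2 ^ a \<le> 2 ^ a + l - r" "2 ^ a \<le> 2 ^ a + l' - r"
      "carries (2 ^ a + l - r - 2 ^ a) (2 ^ a + l' - r - 2 ^ a) = 0"
      using single_carry [of "2 ^ a + l - r" a "2 ^ a + l' - r"] eqs(4) True l l'
      unfolding mods by auto
    have le: "r \<le> l" "r \<le> l'" using sc(1,2) rl by linarith+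
    have "K mod Q = l + l' - 2 * r" using c(2) True le unfolding mods unfolding Q_def by simp
    then have "carries (l + l' - 2 * r) r = 0" using low by simp
    moreover have "carries (l - r) (l' - r) = 0" using sc(3) le by simp
    ultimately have "r = z" using nat_eq_and_if_no_carries le unfolding z_def by blast
    then show ?thesis using True c(1) high by simp
  next
    case False
    then have c0: "c = 0" using c(3) by simp
    define y\<^sub>1 y\<^sub>2 where "y\<^sub>1 = 2 ^ a + l - r" and "y\<^sub>2 = 2 ^ a + l' - r"
    have Kmod: "K mod Q = y\<^sub>1 + y\<^sub>2" using c(2) c0 unfolding mods y\<^sub>1_def y\<^sub>2_def by simp
    have yy: "carries y\<^sub>1 y\<^sub>2 = 0" using eqs(4) c0 unfolding mods y\<^sub>1_def y\<^sub>2_def by simp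
    have "y\<^sub>1 + y\<^sub>2 = or y\<^sub>1 y\<^sub>2"
      using yy by (intro disjunctive_add_eq_or) (simp add: carries_eq_0_iff)
    then have "and (or y\<^sub>1 y\<^sub>2) r = 0" using low Kmod by (simp add: carries_eq_0_iff)
    then have yr: "carries y\<^sub>1 r = 0" "carries y\<^sub>2 r = 0"
      unfolding carries_eq_0_iff by (auto simp: bit_eq_iff bit_simps)
    have sums: "y\<^sub>1 + r = 2 ^ a + l" "y\<^sub>2 + r = 2 ^ a + l'" using rl by (simp_all add: y\<^sub>1_def y\<^sub>2_def)
    \<comment> \<open>If \<open>r\<close> did not remove the digit at position \<open>a\<close>,
      both \<open>y\<^sub>1\<close> and \<open>y\<^sub>2\<close> would keep it and their sum would
      overflow, contrary to \<open>c = 0\<close>.\<close>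
    have "2 ^ a \<le> r"
    proof (rule ccontr)
      assume "\<not> ?thesis"
      then have "r < 2 ^ a" by simp
      then have "\<not> y\<^sub>1 < 2 ^ a" "\<not> y\<^sub>2 < 2 ^ a"
        using carries_0_add_less [OF yr(1), of a] carries_0_add_less [OF yr(2), of a] sums by auto
      then have "Q \<le> y\<^sub>1 + y\<^sub>2" by (simp add: Q_def)
      then show False using Kmod by (metis Q_def mod_less_divisor not_le pos2 zero_less_power)
    qed
    then obtain i where i: "r = 2 ^ a + i" using le_Suc_ex by blast
    have il: "i \<le> l" "i \<le> l'" using rl i by simp_all
    have yi: "y\<^sub>1 = l - i" "y\<^sub>2 = l' - i" by (simp_all add: y\<^sub>1_def y\<^sub>2_def i)
    have "carries (l + l' - 2 * i) i = 0"
    proof -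
      have e: "l + l' - 2 * i = y\<^sub>1 + y\<^sub>2" using il yi by simp
      have "i < 2 ^ a" using il l by simp
      have less: "y\<^sub>1 + y\<^sub>2 < 2 ^ a"
        using carries_0_add_less [OF yy, of a] yi l l' by auto
      have sum: "y\<^sub>1 + y\<^sub>2 + i < 2 ^ Suc a" using less \<open>i < 2 ^ a\<close> by simp
      have "and (y\<^sub>1 + y\<^sub>2) (1 * 2 ^ a + i) = 0" using low Kmod i by (simp add: carries_eq_0_iff)
      then have "take_bit a (and (y\<^sub>1 + y\<^sub>2) (1 * 2 ^ a + i)) = 0" by simp
      then have "and (take_bit a (y\<^sub>1 + y\<^sub>2)) (take_bit a (1 * 2 ^ a + i)) = 0" by (simp only: take_bit_and)
      moreover have "take_bit a (y\<^sub>1 + y\<^sub>2) = y\<^sub>1 + y\<^sub>2" "take_bit a (1 * 2 ^ a + i) = i"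
        using less \<open>i < 2 ^ a\<close> by (simp_all add: take_bit_eq_mod)
      ultimately show ?thesis unfolding e by (simp add: carries_eq_0_iff)
    qed
    then have "i = z" using nat_eq_and_if_no_carries [of i l l'] il yy yi unfolding z_def by simp
    then show ?thesis using c0 c(1) high i by simp
  qed
  have Kx: "K = K div Q * Q + x"
  proof -
    have xz: "x + 2 * z = l + l'" using x_props by (simp add: x_def)
    have "n + m = (h + h' + 1) * Q + x + 2 * z"
      using xz by (simp add: n_def m_def Q_def algebra_simps)
    then show ?thesis using sol by (auto simp: K_def Q_def algebra_simps)
  qed
  have k: "k = K div Q * Q + k mod Q" using high(3) by (metis div_mult_mod_eq)
  have "1 \<le> k" "k \<le> K + 1" using v by (auto simp: valid_def K_def)
  have "adm (K div Q) (k mod Q)"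
    unfolding adm_def Q_def [symmetric] k [symmetric]
  proof (intro conjI)
    show "k mod Q \<le> x + 1" using \<open>k \<le> K + 1\<close> k Kx by linarith
    have "K + 1 - k = x + 1 - k mod Q" using k Kx by linarith
    then show "carries (2 * k - 2) (x + 1 - k mod Q) = 0" using eqs(6) by simp
  qed fact
  then show ?thesis using sol high(3) by (simp add: Q_def)
qed

text \<open>A positive excess costs at least \<open>2 ^ a\<close>, more than the weight of the best
  low index \<open>j\<^sub>0\<close>. So only pairs of excess 0 compete: there
  \<open>j\<^sub>0\<close> is optimal, and the high block takes one of two adjacent values.\<close>

lemma cost_two_minima:
  assumes "n \<noteq> m"
  obtains M r\<^sub>1 k\<^sub>1 r\<^sub>2 k\<^sub>2 where "valid r\<^sub>1 k\<^sub>1" "valid r\<^sub>2 k\<^sub>2" "k\<^sub>1 = k\<^sub>2 + 2 ^ Suc a"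
    "2 ^ a * cost r\<^sub>1 k\<^sub>1 - int k\<^sub>1 = M" "2 ^ a * cost r\<^sub>2 k\<^sub>2 - int k\<^sub>2 = M"
    "\<And>r k. valid r k \<Longrightarrow> (r, k) \<noteq> (r\<^sub>1, k\<^sub>1) \<Longrightarrow> (r, k) \<noteq> (r\<^sub>2, k\<^sub>2) \<Longrightarrow>
       M < 2 ^ a * cost r k - int k"
proof -
  define wt where "wt j = 2 ^ a * int (bitsum j) - int j" for j
  obtain j\<^sub>0 where j0: "wt j\<^sub>0 < 2 ^ a"
    "\<And>H. x \<ge> 1 \<or> H \<ge> 1 \<Longrightarrow> adm H j\<^sub>0"
    "\<And>H j. adm H j \<Longrightarrow> j \<noteq> j\<^sub>0 \<Longrightarrow> wt j\<^sub>0 < wt j"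
    using low_index_minimizer [OF x_props(5) a] unfolding adm_def wt_def by metis
  \<comment> \<open>Admissibility of \<open>j\<^sub>0\<close> for the smaller high block
    \<open>h + h'\<close> requires this; it fails only for \<open>n = m = 2 ^ a + l\<close>.\<close>
  have ne: "x \<ge> 1 \<or> h + h' \<ge> 1"
  proof (rule ccontr)
    assume "\<not> ?thesis"
    then have 0: "x = 0" "h = 0" "h' = 0" by simp_all
    have "l = z" "l' = z" using x_props(1,2) 0(1) unfolding x_def by linarith+
    then have "n = m" unfolding n_def m_def using 0 by simp
    then show False using assms by contradiction
  qed
  have eq: "2 ^ a * cost r k - int k =
      2 ^ a * (excess r k - G h - G h') + wt (k mod 2 ^ Suc a)" for r k
  proof -
    have "int k = 2 ^ a * (2 * int (k div 2 ^ Suc a)) + int (k mod 2 ^ Suc a)"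
    proof -
      have "k = 2 ^ Suc a * (k div 2 ^ Suc a) + k mod 2 ^ Suc a" by simp
      then have "int k = int (2 ^ Suc a * (k div 2 ^ Suc a)) + int (k mod 2 ^ Suc a)"
        by (simp only: flip: of_nat_add)
      then show ?thesis by simp
    qed
    moreover have "cost r k = excess r k - G h - G h' + 2 * int (k div 2 ^ Suc a) + int (bitsum (k mod 2 ^ Suc a))"
      by (simp add: excess_def)
    ultimately have "2 ^ a * cost r k - int k =
        2 ^ a * (excess r k - G h - G h' + 2 * int (k div 2 ^ Suc a) + int (bitsum (k mod 2 ^ Suc a)))
        - (2 ^ a * (2 * int (k div 2 ^ Suc a)) + int (k mod 2 ^ Suc a))"
      by presburger
    then show ?thesis by (simp add: wt_def algebra_simps)
  qed
  define M where "M = 2 ^ a * (- G h - G h') + wt j\<^sub>0"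
  define H\<^sub>1 H\<^sub>2 where "H\<^sub>1 = h + h' + 1" and "H\<^sub>2 = h + h'"
  define k\<^sub>1 k\<^sub>2 where "k\<^sub>1 = H\<^sub>1 * 2 ^ Suc a + j\<^sub>0" and "k\<^sub>2 = H\<^sub>2 * 2 ^ Suc a + j\<^sub>0"
  have adm: "adm H\<^sub>1 j\<^sub>0" "adm H\<^sub>2 j\<^sub>0" using j0(2) ne by (auto simp: H\<^sub>1_def H\<^sub>2_def)
  have s1: "z = z \<and> H\<^sub>1 = h + h' + 1 \<or> z = z + 2 ^ a \<and> H\<^sub>1 = h + h'" by (simp add: H\<^sub>1_def)
  have s2: "z + 2 ^ a = z \<and> H\<^sub>2 = h + h' + 1 \<or> z + 2 ^ a = z + 2 ^ a \<and> H\<^sub>2 = h + h'" by (simp add: H\<^sub>2_def)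
  note sol1 = excess_solution [OF s1 adm(1), folded k\<^sub>1_def]
  note sol2 = excess_solution [OF s2 adm(2), folded k\<^sub>2_def]
  show ?thesis
  proof (rule that)
    show "valid z k\<^sub>1" "valid (z + 2 ^ a) k\<^sub>2" using sol1 sol2 by simp_all
    show "k\<^sub>1 = k\<^sub>2 + 2 ^ Suc a" by (simp add: k\<^sub>1_def k\<^sub>2_def H\<^sub>1_def H\<^sub>2_def)
    show "2 ^ a * cost z k\<^sub>1 - int k\<^sub>1 = M" "2 ^ a * cost (z + 2 ^ a) k\<^sub>2 - int k\<^sub>2 = M"
      unfolding eq sol1 sol2 M_def by simp_all
    fix r k assume v: "valid r k" and neq: "(r, k) \<noteq> (z, k\<^sub>1)" "(r, k) \<noteq> (z + 2 ^ a, k\<^sub>2)"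
    show "M < 2 ^ a * cost r k - int k"
    proof (cases "excess r k = 0")
      case True
      have "k mod 2 ^ Suc a \<noteq> j\<^sub>0"
      proof
        assume "k mod 2 ^ Suc a = j\<^sub>0"
        then have "k = k div 2 ^ Suc a * 2 ^ Suc a + j\<^sub>0" by (metis div_mult_mod_eq)
        then show False
          using excess_eq_0 [OF v True] neq unfolding k\<^sub>1_def k\<^sub>2_def H\<^sub>1_def H\<^sub>2_def by metis
      qed
      then have "wt j\<^sub>0 < wt (k mod 2 ^ Suc a)" using excess_eq_0 [OF v True] j0(3) by blast
      then show ?thesis unfolding eq True M_def by simp
    next
      case False
      then have "1 \<le> excess r k" using excess_nonneg [OF v] by simp
      then have "2 ^ a * 1 \<le> (2::int) ^ a * excess r k" by (intro mult_left_mono) auto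
      moreover have "wt (k mod 2 ^ Suc a) \<ge> 0"
      proof -
        have "k mod 2 ^ Suc a \<le> 2 ^ a * bitsum (k mod 2 ^ Suc a)"
          by (rule le_power2_mult_bitsum) simp
        then have "int (k mod 2 ^ Suc a) \<le> int (2 ^ a * bitsum (k mod 2 ^ Suc a))"
          by (simp only: of_nat_le_iff)
        then show ?thesis by (simp add: wt_def)
      qed
      moreover have "(2::int) ^ a * (excess r k - G h - G h') = 2 ^ a * excess r k + 2 ^ a * (- G h - G h')"
        by (simp add: algebra_simps)
      ultimately show ?thesis
        using j0(1) unfolding eq M_def by linarith
    qed
  qed
qed

end

section \<open>Legendre polynomials\<close>

definition shifted_legendre :: "nat \<Rightarrow> rat poly" where
  "shifted_legendre n = (\<Sum>k\<le>n. monom (of_nat ((n choose k) * ((n + k) choose k))) k)"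

lemma coeff_shifted_legendre:
  "coeff (shifted_legendre n) k = of_nat ((n choose k) * ((n + k) choose k))"
  by (cases "k \<le> n") (simp_all add: shifted_legendre_def coeff_sum)

lemma coeff_shifted_legendre_fact:
  assumes "k \<le> n"
  shows "coeff (shifted_legendre n) k = fact (n + k) / (fact (n - k) * fact k ^ 2)"
  using assms by (simp add: coeff_shifted_legendre binomial_fact power2_eq_square)

lemma degree_shifted_legendre: "degree (shifted_legendre n) = n"
proof (rule antisym)
  show "degree (shifted_legendre n) \<le> n"
    by (rule degree_le) (simp add: coeff_shifted_legendre)
  show "n \<le> degree (shifted_legendre n)"
    by (rule le_degree) (simp add: coeff_shifted_legendre)
qed

lemma shifted_legendre_0: "shifted_legendre 0 = 1"
  by (simp add: shifted_legendre_def one_pCons)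

lemma shifted_legendre_1: "shifted_legendre 1 = [:1, 2:]"
  by (simp add: shifted_legendre_def monom_altdef)

text \<open>The Legendre equation in the variable \<open>t\<close>, in self-adjoint form. On
  coefficients it is the two-term recurrence \<open>rec\<close>.\<close>

lemma shifted_legendre_ode:
  "pderiv ([:0, 1, 1:] * pderiv (shifted_legendre n)) = smult (of_nat (n * (n + 1))) (shifted_legendre n)"
proof (rule poly_eqI)
  fix k
  let ?p = "shifted_legendre n"
  have rec: "of_nat (Suc k) ^ 2 * coeff ?p (Suc k) = (of_nat (n * (n + 1)) - of_nat (k * (k + 1))) * coeff ?p k"
  proof (cases "k \<le> n")
    case True
    have 1: "Suc k * (n choose Suc k) = (n - k) * (n choose k)"
      using binomial_absorption [of k n] binomial_absorb_comp [of n k] by (simp add: mult.commute)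
    have 2: "Suc k * ((n + Suc k) choose Suc k) = Suc (n + k) * ((n + k) choose k)"
      using Suc_times_binomial_eq [of "n + k" k] by (simp add: mult.commute)
    have "Suc k ^ 2 * ((n choose Suc k) * ((n + Suc k) choose Suc k))
        = (Suc k * (n choose Suc k)) * (Suc k * ((n + Suc k) choose Suc k))"
      by (simp only: power2_eq_square mult_ac)
    also have "\<dots> = ((n - k) * Suc (n + k)) * ((n choose k) * ((n + k) choose k))"
      unfolding 1 2 by (simp only: mult_ac)
    finally have "of_nat (Suc k ^ 2 * ((n choose Suc k) * ((n + Suc k) choose Suc k)))
        = (of_nat (((n - k) * Suc (n + k)) * ((n choose k) * ((n + k) choose k))) :: rat)"
      by (simp only: of_nat_eq_iff)
    then have "of_nat (Suc k) ^ 2 * coeff ?p (Suc k) = (of_nat (n - k) * of_nat (Suc (n + k))) * coeff ?p k"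
      unfolding coeff_shifted_legendre by (simp only: of_nat_mult of_nat_power)
    moreover have "of_nat (n - k) * of_nat (Suc (n + k)) = (of_nat (n * (n + 1)) - of_nat (k * (k + 1)) :: rat)"
      using True by (simp add: of_nat_diff algebra_simps)
    ultimately show ?thesis by simp
  next
    case False
    then show ?thesis by (simp add: coeff_shifted_legendre binomial_eq_0)
  qed
  have "coeff (pderiv ([:0, 1, 1:] * pderiv ?p)) k
      = of_nat (Suc k) ^ 2 * coeff ?p (Suc k) + of_nat (k * (k + 1)) * coeff ?p k"
    by (cases k) (simp_all add: coeff_pderiv algebra_simps power2_eq_square)
  then show "coeff (pderiv ([:0, 1, 1:] * pderiv ?p)) k = coeff (smult (of_nat (n * (n + 1))) ?p) k"
    by (simp only: rec coeff_smult left_diff_distrib diff_add_cancel)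
qed

text \<open>Bonnet's recurrence with \<open>x = 1 + 2 t\<close>, checked on coefficients.\<close>

lemma shifted_legendre_rec:
  "smult (of_nat (n + 2)) (shifted_legendre (n + 2)) =
     smult (of_nat (2 * n + 3)) ([:1, 2:] * shifted_legendre (n + 1))
     - smult (of_nat (n + 1)) (shifted_legendre n)"
proof (rule poly_eqI)
  fix k
  \<comment> \<open>All coefficients involved are integer multiples of this number. The multipliers
    vanish at the borders \<open>k = n + 1\<close> and \<open>k = n + 2\<close> where the
    coefficients do.\<close>
  define c where "c = (fact (n + k) / (fact (n + 2 - k) * fact k ^ 2) :: rat)"
  have 2: "coeff (shifted_legendre (n + 2)) k = of_nat ((n + 2 + k) * (n + 1 + k)) * c"
    if "k \<le> n + 2"
  proof -
    have "fact (n + 2 + k) = (of_nat ((n + 2 + k) * (n + 1 + k)) * fact (n + k) :: rat)"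
      by (simp add: algebra_simps)
    then show ?thesis unfolding coeff_shifted_legendre_fact [OF that] c_def by simp
  qed
  have 1: "coeff (shifted_legendre (n + 1)) k = of_nat ((n + 1 + k) * (n + 2 - k)) * c"
    if "k \<le> n + 2"
  proof (cases "k = n + 2")
    case True
    then have "(n + 1) choose k = 0" "n + 2 - k = 0" by (simp_all add: binomial_eq_0 del: binomial_Suc_Suc)
    then show ?thesis unfolding coeff_shifted_legendre by (simp only: mult_zero_left mult_zero_right of_nat_0)
  next
    case False
    then have "k \<le> n + 1" using that by simp
    then obtain i where i: "n + 1 = k + i" using le_Suc_ex by blast
    then have idx: "n + 2 - k = Suc i" "n + 1 - k = i" by simp_all
    have f: "fact (n + 1 + k) = (of_nat (n + 1 + k) * fact (n + k) :: rat)" by simp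
    show ?thesis
      unfolding coeff_shifted_legendre_fact [OF \<open>k \<le> n + 1\<close>] c_def idx f fact_Suc of_nat_mult
      by (simp del: of_nat_Suc of_nat_add)
  qed
  have 0: "coeff (shifted_legendre n) k = of_nat ((n + 2 - k) * (n + 1 - k)) * c"
    if "k \<le> n + 2"
  proof (cases "k \<le> n")
    case False
    then show ?thesis by (simp add: coeff_shifted_legendre)
  next
    case True
    then obtain i where i: "n = k + i" using le_Suc_ex by auto
    then have idx: "n + 2 - k = Suc (Suc i)" "n + 1 - k = Suc i" "n - k = i" by simp_all
    show ?thesis
      unfolding coeff_shifted_legendre_fact [OF True] c_def idx fact_Suc of_nat_mult
      by (simp del: of_nat_Suc of_nat_add)
  qed
  have X: "coeff ([:1, 2:] * shifted_legendre (n + 1)) k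
      = of_nat ((n + 1 + k) * (n + 2 - k) + 2 * k ^ 2) * c" if "k \<le> n + 2"
  proof (cases k)
    case 0
    then show ?thesis using 1 [OF that] by simp
  next
    case (Suc j)
    then have idx: "n + 1 - j = n + 2 - k" "n + 1 + j = n + k" by simp_all
    have "j \<le> n + 1" using that Suc by simp
    have f: "fact k = (of_nat k * fact j :: rat)" using Suc by simp
    have "(of_nat k :: rat) \<noteq> 0" using Suc by simp
    then have "coeff (shifted_legendre (n + 1)) j = of_nat (k ^ 2) * c"
      unfolding coeff_shifted_legendre_fact [OF \<open>j \<le> n + 1\<close>] idx c_def f by (simp add: power_mult_distrib)
    moreover have "coeff ([:1, 2:] * shifted_legendre (n + 1)) k
        = coeff (shifted_legendre (n + 1)) k + 2 * coeff (shifted_legendre (n + 1)) j"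
      by (simp add: Suc)
    moreover have "of_nat (y + 2 * z) * c = of_nat y * c + 2 * (of_nat z * c)" for y z
      by (simp add: distrib_right)
    ultimately show ?thesis unfolding 1 [OF that] by (simp only:)
  qed
  show "coeff (smult (of_nat (n + 2)) (shifted_legendre (n + 2))) k =
     coeff (smult (of_nat (2 * n + 3)) ([:1, 2:] * shifted_legendre (n + 1))
     - smult (of_nat (n + 1)) (shifted_legendre n)) k"
  proof (cases "k \<le> n + 2")
    case True
    have ring: "(of_nat (n + 2) * (of_nat (n + 2 + k) * of_nat (n + 1 + k)) :: rat) =
      of_nat (2 * n + 3) * (of_nat (n + 1 + k) * of_nat (n + 2 - k) + 2 * of_nat k ^ 2)
      - of_nat (n + 1) * (of_nat (n + 2 - k) * of_nat (n + 1 - k))"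
    proof (cases "k = n + 2")
      case True
      then show ?thesis by (simp add: algebra_simps power2_eq_square)
    next
      case False
      then have "of_nat (n + 2 - k) = (of_nat n + 2 - of_nat k :: rat)"
        "of_nat (n + 1 - k) = (of_nat n + 1 - of_nat k :: rat)"
        using True by (simp_all add: of_nat_diff)
      then show ?thesis by (simp add: algebra_simps power2_eq_square)
    qed
    have "coeff (smult (of_nat (n + 2)) (shifted_legendre (n + 2))) k
      = (of_nat (n + 2) * (of_nat (n + 2 + k) * of_nat (n + 1 + k))) * c"
      unfolding coeff_smult 2 [OF True] by (simp only: of_nat_mult mult.assoc)
    also have "\<dots> = (of_nat (2 * n + 3) * (of_nat (n + 1 + k) * of_nat (n + 2 - k) + 2 * of_nat k ^ 2)
      - of_nat (n + 1) * (of_nat (n + 2 - k) * of_nat (n + 1 - k))) * c"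
      by (simp only: ring)
    also have "\<dots> = of_nat (2 * n + 3) * (of_nat ((n + 1 + k) * (n + 2 - k) + 2 * k ^ 2) * c)
      - of_nat (n + 1) * (of_nat ((n + 2 - k) * (n + 1 - k)) * c)"
      by (simp only: of_nat_mult of_nat_add of_nat_power of_nat_numeral left_diff_distrib mult.assoc)
    finally show ?thesis unfolding coeff_diff coeff_smult X [OF True] 0 [OF True] .
  next
    case False
    have z: "coeff (shifted_legendre i) j = 0" if "i < j" for i j
      using that by (simp add: coeff_shifted_legendre binomial_eq_0)
    obtain j where "k = Suc j" "j > n + 1" using False by (cases k) auto
    then show ?thesis by (simp add: z)
  qed
qed

lemma pochhammer_Suc_of_nat:
  "pochhammer (of_nat (Suc k)) n = (fact (k + n) / fact k :: 'a :: field_char_0)"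
proof (induction n)
  case (Suc n)
  have "pochhammer (of_nat (Suc k)) (Suc n) = (fact (k + n) / fact k :: 'a) * of_nat (Suc (k + n))"
    unfolding pochhammer_Suc Suc by (simp add: add_ac)
  then show ?case by (simp add: mult.commute)
qed simp

text \<open>The polynomial \<open>x^2 - 1\<close> becomes \<open>4 t (t + 1)\<close>, and each
  derivative brings a factor 2 by the chain rule. The powers of 2 cancel, leaving the
  \<open>n\<close>-th derivative of \<open>(t (t + 1))^n\<close> divided by
  \<open>fact n\<close>.\<close>

lemma legendre_poly_pcompose: "pcompose (legendre_poly n) [:1, 2:] = shifted_legendre n"
proof -
  let ?q = "[:1, 2:] :: rat poly"
  have chain: "(pderiv ^^ j) (pcompose p ?q) = smult (2 ^ j) (pcompose ((pderiv ^^ j) p) ?q)" for j p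
  proof (induction j)
    case (Suc j)
    have "pderiv ?q = [:2:]" by (simp add: pderiv_pCons)
    then show ?case using Suc by (simp add: pderiv_smult pderiv_pcompose mult.commute)
  qed simp
  have pow: "pcompose (p ^ j) ?q = pcompose p ?q ^ j" for p j
    by (induction j) (simp_all add: pcompose_mult pcompose_1)
  have "pcompose [:-1, 0, 1:] ?q = smult 4 ([:0, 1:] * [:1, 1:])"
    by (simp add: pcompose_pCons)
  then have "pcompose ([:-1, 0, 1:] ^ n) ?q = smult (4 ^ n) (monom 1 n * [:1, 1:] ^ n)"
    by (simp only: pow smult_power power_mult_distrib monom_altdef smult_1_left)
  then have "smult (2 ^ n) (pcompose ((pderiv ^^ n) ([:-1, 0, 1:] ^ n)) ?q)
    = smult (4 ^ n) ((pderiv ^^ n) (monom 1 n * [:1, 1:] ^ n))"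
    unfolding chain [symmetric] by (simp only: higher_pderiv_smult)
  then have "smult (1 / (4 ^ n * fact n)) (smult (2 ^ n) (pcompose ((pderiv ^^ n) ([:-1, 0, 1:] ^ n)) ?q))
    = smult (1 / (4 ^ n * fact n)) (smult (4 ^ n) ((pderiv ^^ n) (monom 1 n * [:1, 1:] ^ n)))"
    by (simp only:)
  moreover have "1 / (4 ^ n * fact n) * 2 ^ n = (1 / (2 ^ n * fact n) :: rat)"
  proof -
    have "(4::rat) ^ n = 2 ^ n * 2 ^ n" by (simp flip: power_mult_distrib)
    then show ?thesis by simp
  qed
  ultimately have "pcompose (legendre_poly n) ?q
      = smult (1 / fact n) ((pderiv ^^ n) (monom 1 n * [:1, 1:] ^ n))"
    by (simp add: legendre_poly_def pcompose_smult)
  moreover have "smult (1 / fact n) ((pderiv ^^ n) (monom 1 n * [:1, 1:] ^ n)) = shifted_legendre n"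
  proof (rule poly_eqI)
    fix k
    have "coeff ((pderiv ^^ n) (monom 1 n * [:1, 1:] ^ n)) k
        = fact (k + n) / fact k * (of_nat (n choose k) :: rat)"
      unfolding coeff_higher_pderiv pochhammer_Suc_of_nat coeff_monom_mult
      by (cases "k \<le> n") (simp_all add: coeff_linear_poly_power coeff_eq_0 degree_linear_power)
    moreover have "of_nat (n + k choose k) = (fact (n + k) / (fact k * fact n) :: rat)"
      by (simp add: binomial_fact)
    ultimately show "coeff (smult (1 / fact n) ((pderiv ^^ n) (monom 1 n * [:1, 1:] ^ n))) k
        = coeff (shifted_legendre n) k"
      by (simp add: coeff_shifted_legendre add.commute mult.commute)
  qed
  ultimately show ?thesis by simp
qed

section \<open>Adams' product formula\<close>

lemma shifted_legendre_mult_X: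
  assumes "K \<ge> 1"
  shows "[:1, 2:] * shifted_legendre K =
    smult (of_nat (K + 1) / of_nat (2 * K + 1)) (shifted_legendre (K + 1))
    + smult (of_nat K / of_nat (2 * K + 1)) (shifted_legendre (K - 1))"
proof -
  obtain n where K: "K = n + 1" using assms by (metis add.commute le_Suc_ex)
  have nz: "(of_nat (2 * n + 3) :: rat) \<noteq> 0" by (simp flip: of_nat_Suc)
  have "smult (of_nat (2 * n + 3)) ([:1, 2:] * shifted_legendre (n + 1)) =
    smult (of_nat (n + 2)) (shifted_legendre (n + 2)) + smult (of_nat (n + 1)) (shifted_legendre n)"
    using shifted_legendre_rec [of n] by simp
  then have "smult (inverse (of_nat (2 * n + 3))) (smult (of_nat (2 * n + 3)) ([:1, 2:] * shifted_legendre (n + 1))) =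
    smult (inverse (of_nat (2 * n + 3))) (smult (of_nat (n + 2)) (shifted_legendre (n + 2)) + smult (of_nat (n + 1)) (shifted_legendre n))"
    by simp
  moreover have "inverse (of_nat (2 * n + 3)) * of_nat (2 * n + 3) = (1::rat)"
    using nz by (rule left_inverse)
  ultimately show ?thesis
    unfolding K smult_add_right smult_smult by (simp add: divide_inverse mult.commute algebra_simps)
qed

text \<open>The numbers \<open>(1/2)\<^sub>r / r!\<close> in Adams' formula.\<close>

definition cbin :: "nat \<Rightarrow> rat" where
  "cbin r = of_nat (2 * r choose r) / 4 ^ r"

lemma cbin_0 [simp]: "cbin 0 = 1"
  by (simp add: cbin_def)

lemma cbin_nonzero [simp]: "cbin r \<noteq> 0"
  by (simp add: cbin_def)

lemma cbin_1: "cbin (Suc 0) = 1 / 2"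
  by (simp add: cbin_def)

lemma cbin_Suc: "cbin (Suc r) = cbin r * (2 * of_nat r + 1) / (2 * of_nat r + 2)"
proof -
  have c: "of_nat (2 * j choose j) = (fact (2 * j) / (fact j * fact j) :: rat)" for j
    by (simp add: binomial_fact)
  have e1: "fact (2 * Suc r) = 2 * (of_nat r + 1) * (2 * of_nat r + 1) * (fact (2 * r) :: rat)"
    by (simp add: algebra_simps)
  have e2: "fact (Suc r) = (of_nat r + 1) * (fact r :: rat)" by simp
  have e3: "2 * of_nat r + 2 = (2 * (of_nat r + 1) :: rat)" by simp
  have *: "(2 * x * y * F / ((x * f) * (x * f))) / (4 * p) = F / (f * f) / p * y / (2 * x)"
    if "x \<noteq> 0" "f \<noteq> 0" "p \<noteq> 0" for x y F f p :: rat
    using that by (simp add: field_simps)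
  show ?thesis
    unfolding cbin_def c e1 e2 e3 power_Suc by (rule *) (simp_all add: add_nonneg_eq_0_iff)
qed

definition adams :: "nat \<Rightarrow> nat \<Rightarrow> nat \<Rightarrow> rat" where
  "adams n m r = cbin r * cbin (m - r) * cbin (n - r) / cbin (n + m - r)
     * of_nat (2 * (n + m - 2 * r) + 1) / of_nat (2 * (n + m - r) + 1)"

text \<open>
  The recurrence of \<open>adams_step\<close> with \<open>s = m - r\<close>, \<open>u = n - r\<close>, divided by
  \<open>cbin r * cbin s * cbin (u - 1) / cbin (n + m - r)\<close>.
\<close>

lemma adams_rational_identity:
  fixes r s u :: rat
  assumes "r \<ge> 0" "s \<ge> 0" "u > 0"
  defines "N \<equiv> r + s + u"
  shows "(r + s + 2) * ((2 * r + 1) / (2 * r + 2)) * ((2 * s + 1) / (2 * s + 2)) * ((2 * N + 2) / (2 * N + 1)) * ((2 * (s + u) + 1) / (2 * N + 3))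
    = (2 * (r + s) + 3) * ((2 * r + 1) / (2 * r + 2)) * ((s + u) / (2 * N + 1))
      + (2 * (r + s) + 3) * ((2 * s + 1) / (2 * s + 2)) * ((2 * u - 1) / (2 * u)) * ((2 * N + 2) / (2 * N + 1)) * ((s + u + 1) / (2 * N + 3))
      - (r + s + 1) * ((2 * u - 1) / (2 * u)) * ((2 * (s + u) + 1) / (2 * N + 1))"
proof -
  have nz: "2 * r + 2 \<noteq> 0" "2 * s + 2 \<noteq> 0" "u \<noteq> 0" "2 * N + 1 \<noteq> 0" "2 * N + 3 \<noteq> 0"
    using assms by (simp_all add: N_def add_nonneg_eq_0_iff)
  define R S V D E where "R = 2 * r + 2" and "S = 2 * s + 2" and "V = 2 * u"
    and "D = 2 * N + 1" and "E = 2 * N + 3"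
  have nz': "R \<noteq> 0" "S \<noteq> 0" "V \<noteq> 0" "D \<noteq> 0" "E \<noteq> 0"
    using nz by (simp_all add: R_def S_def V_def D_def E_def)
  have poly: "(r + s + 2) * (2 * r + 1) * (2 * s + 1) * (2 * N + 2) * (2 * (s + u) + 1) * (2 * u)
    = (2 * (r + s) + 3) * (2 * r + 1) * (s + u) * (2 * s + 2) * (2 * u) * (2 * N + 3)
      + (2 * (r + s) + 3) * (2 * s + 1) * (2 * u - 1) * (2 * N + 2) * (s + u + 1) * (2 * r + 2)
      - (r + s + 1) * (2 * u - 1) * (2 * (s + u) + 1) * (2 * r + 2) * (2 * s + 2) * (2 * N + 3)"
    unfolding N_def by (simp add: algebra_simps)
  define P where "P = R * S * V * D * E"
  have f1: "c * (x / R) * (y / S) * (z / D) * (w / E) = c * x * y * z * w * V / P"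
    and f2: "c * (x / R) * (y / D) = c * x * y * S * V * E / P"
    and f3: "c * (x / S) * (y / V) * (z / D) * (w / E) = c * x * y * z * w * R / P"
    and f4: "c * (x / V) * (y / D) = c * x * y * R * S * E / P"
    for c x y z w
    using nz' by (simp_all add: P_def)
  show ?thesis
    unfolding R_def [symmetric] S_def [symmetric] V_def [symmetric] D_def [symmetric] E_def [symmetric]
    unfolding f1 f3 unfolding f2 f4
    using poly [folded R_def S_def V_def D_def E_def]
    by (simp only: flip: add_divide_distrib diff_divide_distrib)
qed


text \<open>Comparison of the coefficients of \<open>shifted_legendre (n + m - 2 * r)\<close> after
  Bonnet's recurrence for index \<open>m + 2\<close> has been multiplied by
  \<open>shifted_legendre n\<close>. The two terms with \<open>m + 1\<close> come from the
  neighbouring indices below and above, through \<open>shifted_legendre_mult_X\<close>.\<close>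

lemma adams_step:
  assumes "r \<le> m" "m + 2 \<le> n"
  shows "of_nat (m + 2) * adams n (m + 2) (Suc r) =
    of_nat (2 * m + 3) * adams n (m + 1) (Suc r)
      * (of_nat (n + m - 2 * r) / of_nat (2 * (n + m - 1 - 2 * r) + 1))
    + of_nat (2 * m + 3) * adams n (m + 1) r
      * (of_nat (n + m + 1 - 2 * r) / of_nat (2 * (n + m + 1 - 2 * r) + 1))
    - of_nat (m + 1) * adams n m r"
proof -
  obtain s where m: "m = r + s" using assms(1) le_Suc_ex by blast
  obtain u where n: "n = r + Suc u" using assms m le_Suc_ex [of "Suc r" n] by auto
  define R S V :: rat where "R = of_nat r" and "S = of_nat s" and "V = of_nat (Suc u)"
  define N where "N = R + S + V"
  have pos: "R \<ge> 0" "S \<ge> 0" "V > 0" by (simp_all add: R_def S_def V_def)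
  then have nz: "2 * N + 1 \<noteq> 0" "2 * N + 2 \<noteq> 0" "2 * N + 3 \<noteq> 0" "2 * (S + V) + 1 \<noteq> 0"
    "2 * (S + V) + 3 \<noteq> 0"
    by (simp_all add: N_def add_nonneg_eq_0_iff)
  define B where "B = cbin r * cbin s * cbin u / cbin (r + s + Suc u)"
  have c: "cbin (Suc r) = cbin r * ((2 * R + 1) / (2 * R + 2))"
    "cbin (Suc s) = cbin s * ((2 * S + 1) / (2 * S + 2))"
    "cbin (Suc u) = cbin u * ((2 * V - 1) / (2 * V))"
    "cbin (Suc (r + s + Suc u)) = cbin (r + s + Suc u) * ((2 * N + 1) / (2 * N + 2))"
    by (simp_all add: cbin_Suc R_def S_def V_def N_def algebra_simps)
  have N1: "of_nat (2 * (r + s + Suc u) + 1) = 2 * N + 1"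
    and N3: "of_nat (2 * (r + s + Suc u + 1) + 1) = 2 * N + 3"
    and K: "of_nat (2 * (s + Suc u) + 1) = 2 * (S + V) + 1"
    and K3: "of_nat (2 * (s + Suc u + 1) + 1) = 2 * (S + V) + 3"
    by (simp_all add: N_def R_def S_def V_def)
  have L: "adams n (m + 2) (Suc r)
      = B * ((2 * R + 1) / (2 * R + 2)) * ((2 * S + 1) / (2 * S + 2)) * ((2 * N + 2) / (2 * N + 1))
        * ((2 * (S + V) + 1) / (2 * N + 3))"
  proof -
    have i: "m + 2 - Suc r = Suc s" "n - Suc r = u" "n + (m + 2) - Suc r = Suc (r + s + Suc u)"
      "n + (m + 2) - 2 * Suc r = s + Suc u" "Suc (r + s + Suc u) = r + s + Suc u + 1"
      using m n by simp_all
    show ?thesis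
      unfolding adams_def i(1-4) unfolding c B_def unfolding i(5) N3 K by (simp add: mult_ac)
  qed
  have F: "adams n (m + 1) (Suc r) * (of_nat (n + m - 2 * r) / of_nat (2 * (n + m - 1 - 2 * r) + 1))
      = B * ((2 * R + 1) / (2 * R + 2)) * ((S + V) / (2 * N + 1))"
  proof -
    have i: "m + 1 - Suc r = s" "n - Suc r = u" "n + (m + 1) - Suc r = r + s + Suc u"
      "n + (m + 1) - 2 * Suc r = s + u" "n + m - 1 - 2 * r = s + u" "n + m - 2 * r = s + Suc u"
      using m n by simp_all
    have SV: "of_nat (s + Suc u) = S + V" by (simp add: S_def V_def)
    have "(of_nat (2 * (s + u) + 1) :: rat) \<noteq> 0" by (simp flip: of_nat_Suc)
    then have cancel: "x / y * of_nat (2 * (s + u) + 1) / z * (w / of_nat (2 * (s + u) + 1)) = x / y * (w / z)"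
      for x y z w :: rat by simp
    show ?thesis
      unfolding adams_def i unfolding c B_def N1 SV cancel by (simp add: mult_ac)
  qed
  have T: "adams n m r = B * ((2 * V - 1) / (2 * V)) * ((2 * (S + V) + 1) / (2 * N + 1))"
  proof -
    have i: "m - r = s" "n - r = Suc u" "n + m - r = r + s + Suc u" "n + m - 2 * r = s + Suc u"
      using m n by simp_all
    show ?thesis
      unfolding adams_def i unfolding N1 K unfolding c B_def by (simp add: mult_ac)
  qed
  have G: "adams n (m + 1) r * (of_nat (n + m + 1 - 2 * r) / of_nat (2 * (n + m + 1 - 2 * r) + 1))
      = B * ((2 * S + 1) / (2 * S + 2)) * ((2 * V - 1) / (2 * V)) * ((2 * N + 2) / (2 * N + 1))
        * ((S + V + 1) / (2 * N + 3))"
  proof -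
    have i: "m + 1 - r = Suc s" "n - r = Suc u" "n + (m + 1) - r = Suc (r + s + Suc u)"
      "n + (m + 1) - 2 * r = s + Suc u + 1" "n + m + 1 - 2 * r = s + Suc u + 1"
      "Suc (r + s + Suc u) = r + s + Suc u + 1"
      using m n by simp_all
    have SV: "of_nat (s + Suc u + 1) = S + V + 1" by (simp add: S_def V_def)
    have cancel: "x * (2 * (S + V) + 3) / z * (w / (2 * (S + V) + 3)) = x * (w / z)"
      for x z w using nz by simp
    show ?thesis
      unfolding adams_def i(1-5) unfolding c unfolding i(6) N3 K3 unfolding cancel SV B_def by (simp add: mult_ac)
  qed
  have mm: "of_nat (m + 2) = R + S + 2" "of_nat (2 * m + 3) = 2 * (R + S) + 3" "of_nat (m + 1) = R + S + 1"
    by (simp_all add: m R_def S_def)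
  show ?thesis
    using arg_cong [OF adams_rational_identity [OF pos, folded N_def], of "\<lambda>y. B * y"]
    unfolding mult.assoc [of _ "adams n (m + 1) (Suc r)"] mult.assoc [of _ "adams n (m + 1) r"]
    unfolding L F G T mm distrib_left right_diff_distrib by (simp only: mult_ac)
qed

lemma smult_sum_right: "smult c (\<Sum>i\<in>A. f i) = (\<Sum>i\<in>A. smult c (f i))"
  by (induction A rule: infinite_finite_induct) (simp_all add: smult_add_right)

text \<open>Induction along Bonnet's recurrence. The inner summands match by
  \<open>adams_step\<close>; the first and the last one receive a single contribution each and are
  computed directly.\<close>

lemma adams_product:
  assumes "m \<le> n"
  shows "shifted_legendre m * shifted_legendre n =
    (\<Sum>r\<le>m. smult (adams n m r) (shifted_legendre (n + m - 2 * r)))"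
  using assms
proof (induction m rule: less_induct)
  case (less m)
  let ?p = shifted_legendre
  consider "m = 0" | "m = 1" | k where "m = k + 2"
    by (metis One_nat_def add_2_eq_Suc' not0_implies_Suc)
  then show ?case
  proof cases
    case 1
    then show ?thesis by (simp add: adams_def shifted_legendre_0)
  next
    case 2
    then have n: "n \<ge> 1" using less.prems by simp
    then obtain j where j: "n = Suc j" by (cases n) auto
    have 0: "adams n 1 0 = of_nat (n + 1) / of_nat (2 * n + 1)"
    proof -
      have c: "cbin (n + 1) = cbin n * (2 * of_nat n + 1) / (2 * (of_nat n + 1))"
        using cbin_Suc [of n] by (simp add: algebra_simps)
      have a: "adams n 1 0 = 1 / 2 * cbin n / cbin (n + 1)"
        by (simp add: adams_def cbin_1 del: of_nat_add of_nat_Suc)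
      have f: "1 / 2 * A / (A * y / (2 * x)) = x / y" if "A \<noteq> 0" for A x y :: rat
        using that by simp
      have "adams n 1 0 = (of_nat n + 1) / (2 * of_nat n + 1)"
        unfolding a c by (rule f) simp
      then show ?thesis by (simp add: add.commute)
    qed
    have 1: "adams n 1 1 = of_nat n / of_nat (2 * n + 1)"
    proof -
      have c: "cbin (Suc j) = cbin j * (2 * of_nat j + 1) / (2 * (of_nat j + 1))"
        using cbin_Suc [of j] by (simp add: algebra_simps)
      have a: "adams n 1 1 = 1 / 2 * cbin j / cbin (Suc j) * (2 * of_nat j + 1) / of_nat (2 * n + 1)"
        by (simp add: adams_def cbin_1 j)
      have f: "1 / 2 * A / (A * y / (2 * x)) * y / z = x / z" if "A \<noteq> 0" "y \<noteq> 0" for A x y z :: rat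
        using that by simp
      have "adams n 1 1 = (of_nat j + 1) / of_nat (2 * n + 1)"
        unfolding a c by (rule f) (simp_all add: add_nonneg_eq_0_iff)
      then show ?thesis by (simp add: j add.commute)
    qed
    show ?thesis
      unfolding 2 shifted_legendre_1 shifted_legendre_mult_X [OF n]
      using 0 1 by simp
  next
    case (3 k)
    define q :: "rat poly" where "q = [:1, 2:]"
    have kn: "k + 2 \<le> n" using 3 less.prems by simp
    have IH1: "?p (k + 1) * ?p n = (\<Sum>r\<le>k + 1. smult (adams n (k + 1) r) (?p (n + (k + 1) - 2 * r)))"
      using less.IH [of "k + 1"] 3 kn by simp
    have IH0: "?p k * ?p n = (\<Sum>r\<le>k. smult (adams n k r) (?p (n + k - 2 * r)))"
      using less.IH [of k] 3 kn by simp
    \<comment> \<open>\<open>F\<close> and \<open>S\<close> carry the parts of multiplication by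
      \<open>1 + 2 t\<close> that raise and lower the index; \<open>T\<close> is the subtracted term
      of the recurrence.\<close>
    define F where "F r = of_nat (2 * k + 3) * adams n (k + 1) r
      * (of_nat (n + k + 2 - 2 * r) / of_nat (2 * (n + k + 1 - 2 * r) + 1))" for r
    define S where "S r = of_nat (2 * k + 3) * adams n (k + 1) r
      * (of_nat (n + k + 1 - 2 * r) / of_nat (2 * (n + k + 1 - 2 * r) + 1))" for r
    define T where "T r = of_nat (k + 1) * adams n k r" for r
    have X: "smult (of_nat (2 * k + 3)) (q * smult (adams n (k + 1) r) (?p (n + (k + 1) - 2 * r)))
      = smult (F r) (?p (n + k + 2 - 2 * r)) + smult (S r) (?p (n + k - 2 * r))"
      if "r \<le> k + 1" for r
    proof -
      have K: "n + (k + 1) - 2 * r \<ge> 1" using that kn by simp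
      have i: "n + (k + 1) - 2 * r + 1 = n + k + 2 - 2 * r" "n + (k + 1) - 2 * r - 1 = n + k - 2 * r"
        "n + (k + 1) - 2 * r = n + k + 1 - 2 * r"
        using that kn by simp_all
      show ?thesis
        unfolding mult_smult_right q_def shifted_legendre_mult_X [OF K] i(1,2)
        unfolding i(3) F_def S_def by (simp add: smult_add_right mult_ac)
    qed
    have "smult (of_nat (k + 2)) (?p (k + 2) * ?p n) = smult (of_nat (k + 2)) (?p (k + 2)) * ?p n"
      by simp
    also have "\<dots> = smult (of_nat (2 * k + 3)) (q * (?p (k + 1) * ?p n)) - smult (of_nat (k + 1)) (?p k * ?p n)"
      unfolding shifted_legendre_rec q_def by (simp add: algebra_simps)
    also have "\<dots> = (\<Sum>r\<le>k + 1. smult (F r) (?p (n + k + 2 - 2 * r)))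
        + (\<Sum>r\<le>k + 1. smult (S r) (?p (n + k - 2 * r))) - (\<Sum>r\<le>k. smult (T r) (?p (n + k - 2 * r)))"
    proof -
      have "smult (of_nat (2 * k + 3)) (q * (?p (k + 1) * ?p n))
        = (\<Sum>r\<le>k + 1. smult (F r) (?p (n + k + 2 - 2 * r)) + smult (S r) (?p (n + k - 2 * r)))"
        unfolding IH1 sum_distrib_left smult_sum_right by (intro sum.cong refl X) simp
      moreover have "smult (of_nat (k + 1)) (?p k * ?p n) = (\<Sum>r\<le>k. smult (T r) (?p (n + k - 2 * r)))"
        unfolding IH0 smult_sum_right T_def by simp
      ultimately show ?thesis by (simp only: sum.distrib)
    qed
    also have "(\<Sum>r\<le>k + 1. smult (F r) (?p (n + k + 2 - 2 * r)))
        = smult (F 0) (?p (n + k + 2)) + (\<Sum>r\<le>k. smult (F (Suc r)) (?p (n + k - 2 * r)))"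
      using sum.atMost_Suc_shift [of "\<lambda>r. smult (F r) (?p (n + k + 2 - 2 * r))" k] by simp
    also have "(\<Sum>r\<le>k + 1. smult (S r) (?p (n + k - 2 * r)))
        = (\<Sum>r\<le>k. smult (S r) (?p (n + k - 2 * r))) + smult (S (k + 1)) (?p (n + k - 2 * (k + 1)))"
      by simp
    also have "F 0 = of_nat (k + 2) * adams n (k + 2) 0"
    proof -
      define x y :: rat where "x = of_nat k" and "y = of_nat (n + k)"
      have nz: "x + 2 \<noteq> 0" "y + 2 \<noteq> 0" "2 * y + 3 \<noteq> 0"
        by (simp_all add: x_def y_def add_nonneg_eq_0_iff)
      have c: "cbin (k + 2) = cbin (k + 1) * (2 * x + 3) / (2 * (x + 2))"
        using cbin_Suc [of "k + 1"] by (simp add: x_def algebra_simps)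
      have c': "cbin (n + (k + 2)) = cbin (n + (k + 1)) * (2 * y + 3) / (2 * (y + 2))"
        using cbin_Suc [of "n + (k + 1)"] by (simp add: y_def algebra_simps)
      have a: "adams n (k + 2) 0 = cbin (k + 2) * cbin n / cbin (n + (k + 2))"
        "adams n (k + 1) 0 = cbin (k + 1) * cbin n / cbin (n + (k + 1))"
        by (simp_all add: adams_def del: of_nat_add of_nat_Suc)
      have i: "of_nat (2 * k + 3) = 2 * x + 3" "of_nat (n + k + 2 - 2 * 0) = y + 2"
        "of_nat (2 * (n + k + 1 - 2 * 0) + 1) = 2 * y + 3" "of_nat (k + 2) = x + 2"
        by (simp_all add: x_def y_def)
      have f: "Z * (A * B / C) * (Y / W) = X * (A * Z / (2 * X) * B / (C * W / (2 * Y)))"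
        if "X \<noteq> 0" "Y \<noteq> 0" "W \<noteq> 0" for A B C X Y Z W :: rat
        using that by simp
      show ?thesis unfolding F_def a c c' i by (rule f) (use nz in simp_all)
    qed
    also have "S (k + 1) = of_nat (k + 2) * adams n (k + 2) (k + 2)"
    proof -
      obtain j where j: "n = k + 2 + j" using kn le_Suc_ex by blast
      define x y z :: rat where "x = of_nat k" and "y = of_nat j" and "z = of_nat (2 * n + 1)"
      have nz: "x + 2 \<noteq> 0" "y + 1 \<noteq> 0" "2 * y + 3 \<noteq> 0"
        by (simp_all add: x_def y_def add_nonneg_eq_0_iff)
      have c: "cbin (k + 2) = cbin (k + 1) * (2 * x + 3) / (2 * (x + 2))"
        using cbin_Suc [of "k + 1"] by (simp add: x_def algebra_simps)
      have c': "cbin (j + 1) = cbin j * (2 * y + 1) / (2 * (y + 1))"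
        using cbin_Suc [of j] by (simp add: y_def algebra_simps)
      have idx: "n + (k + 2) - 2 * (k + 2) = j" "n + (k + 2) - (k + 2) = n" "n - (k + 2) = j"
        "n + (k + 1) - 2 * (k + 1) = j + 1" "n + (k + 1) - (k + 1) = n" "n - (k + 1) = j + 1"
        "n + k + 1 - 2 * (k + 1) = j + 1" "k + 2 - (k + 2) = 0" "k + 1 - (k + 1) = 0"
        by (simp_all add: j)
      have i: "of_nat (2 * k + 3) = 2 * x + 3" "of_nat (k + 2) = x + 2" "of_nat (2 * j + 1) = 2 * y + 1"
        "of_nat (2 * (j + 1) + 1) = 2 * y + 3" "of_nat (j + 1) = y + 1"
        by (simp_all add: x_def y_def)
      have f: "Z * (A * 1 * (B * W / (2 * Y)) / C * V / z) * (Y / V) = X * (A * Z / (2 * X) * 1 * B / C * W / z)"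
        if "X \<noteq> 0" "Y \<noteq> 0" "V \<noteq> 0" for A B C X Y Z V W :: rat
        using that by simp
      show ?thesis
        unfolding S_def adams_def idx unfolding c c' cbin_0 i z_def [symmetric]
        by (rule f) (use nz in simp_all)
    qed
    also have "smult (of_nat (k + 2) * adams n (k + 2) 0) (?p (n + k + 2))
        + (\<Sum>r\<le>k. smult (F (Suc r)) (?p (n + k - 2 * r)))
        + ((\<Sum>r\<le>k. smult (S r) (?p (n + k - 2 * r)))
          + smult (of_nat (k + 2) * adams n (k + 2) (k + 2)) (?p (n + k - 2 * (k + 1))))
        - (\<Sum>r\<le>k. smult (T r) (?p (n + k - 2 * r)))
      = smult (of_nat (k + 2) * adams n (k + 2) 0) (?p (n + k + 2))
        + (\<Sum>r\<le>k. smult (of_nat (k + 2) * adams n (k + 2) (Suc r)) (?p (n + k - 2 * r)))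
        + smult (of_nat (k + 2) * adams n (k + 2) (k + 2)) (?p (n + k - 2 * (k + 1)))"
    proof -
      have "of_nat (k + 2) * adams n (k + 2) (Suc r) = F (Suc r) + S r - T r" if "r \<le> k" for r
      proof -
        have i: "n + k + 2 - 2 * Suc r = n + k - 2 * r" "n + k + 1 - 2 * Suc r = n + k - 1 - 2 * r"
          using that kn by simp_all
        show ?thesis unfolding F_def S_def T_def i by (rule adams_step [OF that kn])
      qed
      then have "(\<Sum>r\<le>k. smult (of_nat (k + 2) * adams n (k + 2) (Suc r)) (?p (n + k - 2 * r)))
        = (\<Sum>r\<le>k. smult (F (Suc r)) (?p (n + k - 2 * r)) + smult (S r) (?p (n + k - 2 * r)) - smult (T r) (?p (n + k - 2 * r)))"
        by (intro sum.cong refl) (simp add: smult_add_left smult_diff_left)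
      then show ?thesis by (simp add: sum.distrib sum_subtractf)
    qed
    also have "\<dots> = (\<Sum>r\<le>k + 2. smult (of_nat (k + 2) * adams n (k + 2) r) (?p (n + (k + 2) - 2 * r)))"
    proof -
      have "(\<Sum>r\<le>k. smult (of_nat (k + 2) * adams n (k + 2) (Suc r)) (?p (n + (k + 2) - 2 * Suc r)))
        = (\<Sum>r\<le>k. smult (of_nat (k + 2) * adams n (k + 2) (Suc r)) (?p (n + k - 2 * r)))"
        by simp
      then show ?thesis
        unfolding add_2_eq_Suc' sum.atMost_Suc_shift [of _ "Suc k"] sum.atMost_Suc [of _ k]
        by simp
    qed
    also have "\<dots> = smult (of_nat (k + 2)) (\<Sum>r\<le>k + 2. smult (adams n (k + 2) r) (?p (n + (k + 2) - 2 * r)))"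
      by (simp only: smult_sum_right smult_smult)
    finally have "smult (of_nat (k + 2)) (?p (k + 2) * ?p n)
      = smult (of_nat (k + 2)) (\<Sum>r\<le>k + 2. smult (adams n (k + 2) r) (?p (n + (k + 2) - 2 * r)))" .
    moreover have "(of_nat (k + 2) :: rat) \<noteq> 0" by (simp flip: of_nat_Suc)
    ultimately show ?thesis
      unfolding 3 by (metis smult_cancel)
  qed
qed

section \<open>The Newton polygon of \<open>shifted_legendre n\<close>\<close>

lemma coeff_shifted_legendre_val2:
  assumes "k \<le> n"
  shows "coeff (shifted_legendre n) k \<noteq> 0"
    and "val2 (coeff (shifted_legendre n) k) = int (bitsum k) + carries (2 * k) (n - k)"
proof -
  show nz: "coeff (shifted_legendre n) k \<noteq> 0" using assms by (simp add: coeff_shifted_legendre)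
  have "val2 (coeff (shifted_legendre n) k) = val2 (fact (n + k)) - (val2 (fact (n - k)) + 2 * val2 (fact k))"
    unfolding coeff_shifted_legendre_fact [OF assms]
    by (simp add: val2_divide val2_mult val2_power)
  also have "2 * k + (n - k) = n + k" using assms by simp
  then have "val2 (fact (n + k)) - (val2 (fact (n - k)) + 2 * val2 (fact k))
      = int (bitsum k) + carries (2 * k) (n - k)"
    using assms unfolding carries_def val2_fact by (simp add: of_nat_diff add.commute)
  finally show "val2 (coeff (shifted_legendre n) k) = int (bitsum k) + carries (2 * k) (n - k)" .
qed

text \<open>The weight of \<open>k\<close> is a sum over its high and its low block. It is minimal
  when the high block is \<open>h\<close> and the low block has weight 0, that is, equals 0 or
  \<open>2 ^ a\<close>; the second choice stays within the degree only if \<open>n\<close> has the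
  digit at position \<open>a\<close>.\<close>

lemma shifted_legendre_edge:
  fixes a n :: nat
  defines "h \<equiv> n div 2 ^ Suc a" and "b \<equiv> n mod 2 ^ Suc a"
  obtains M where "newton_edge (2 ^ a) (shifted_legendre n) M (h * 2 ^ Suc a)
    (h * 2 ^ Suc a + (if b < 2 ^ a then 0 else 2 ^ a))"
proof -
  define Q :: nat where "Q = 2 ^ Suc a"
  have Q: "Q > 0" "Q = 2 * 2 ^ a" by (simp_all add: Q_def)
  define G where "G j = 2 * int j - int (bitsum j)" for j
  have G_less: "G i + 1 \<le> G j" if "i < j" for i j
    using double_minus_bitsum_less [OF that] by (simp add: G_def)
  let ?p = "shifted_legendre n"
  have n: "n = h * Q + b" unfolding h_def b_def Q_def by (simp only: div_mult_mod_eq)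
  have b: "b < Q" using Q by (simp add: b_def Q_def)
  define w where "w k = 2 ^ a * val2 (coeff ?p k) - int k" for k
  have w: "w k = 2 ^ a * (carries (2 * k) (n - k) - G (k div Q))
      + (2 ^ a * int (bitsum (k mod Q)) - int (k mod Q))" if "k \<le> n" for k
  proof -
    have "k = Q * (k div Q) + k mod Q" by simp
    then have "int k = int Q * int (k div Q) + int (k mod Q)" by (simp only: flip: of_nat_mult of_nat_add)
    moreover have "int Q = 2 * 2 ^ a" by (simp add: Q_def)
    moreover have "bitsum k = bitsum (k div Q) + bitsum (k mod Q)"
    proof -
      have "k mod Q < 2 ^ Suc a" using Q by (simp add: Q_def)
      from bitsum_mult_power2_add [OF this, of "k div Q"] show ?thesis
        unfolding Q_def by (simp only: div_mult_mod_eq)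
    qed
    ultimately show ?thesis
      unfolding w_def coeff_shifted_legendre_val2(2) [OF that] G_def by (simp add: algebra_simps)
  qed
  have wt: "2 ^ a * int (bitsum j) - int j \<ge> 0" if "j < Q" for j
  proof -
    have "int j \<le> int (2 ^ a * bitsum j)"
      unfolding of_nat_le_iff using that by (intro le_power2_mult_bitsum) (simp add: Q_def)
    then show ?thesis by simp
  qed
  define M where "M = - (2 ^ a * G h)"
  have ge: "M \<le> w k \<and> (w k = M \<longrightarrow> h * Q \<le> k \<and> k \<le> h * Q + (if b < 2 ^ a then 0 else 2 ^ a))"
    if "k \<le> n" for k
  proof -
    have kh: "k div Q \<le> h" unfolding h_def Q_def using that by (rule div_le_mono)
    have kQ: "k mod Q < Q" using Q by simp
    have c: "carries (2 * k) (n - k) \<ge> 0" by (rule carries_nonneg)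
    show ?thesis
    proof (cases "k div Q = h")
      case True
      then have "2 ^ a * (- G h) \<le> (2::int) ^ a * (carries (2 * k) (n - k) - G (k div Q))"
        using c by (intro mult_left_mono) auto
      then have "M \<le> w k" using wt [OF kQ] unfolding w [OF that] M_def by simp
      moreover have "h * Q \<le> k \<and> k \<le> h * Q + (if b < 2 ^ a then 0 else 2 ^ a)" if eq: "w k = M"
      proof -
        have "2 ^ a * int (bitsum (k mod Q)) - int (k mod Q) = 0"
          using eq wt [OF kQ] \<open>2 ^ a * (- G h) \<le> _\<close> unfolding w [OF \<open>k \<le> n\<close>] M_def by simp
        then have "int (2 ^ a * bitsum (k mod Q)) = int (k mod Q)" by simp
        then have e: "2 ^ a * bitsum (k mod Q) = k mod Q" by (simp only: of_nat_eq_iff)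
        then have "2 ^ a * bitsum (k mod Q) < 2 ^ a * 2" using kQ Q(2) by (metis mult.commute)
        then have "bitsum (k mod Q) < 2" by simp
        then have "bitsum (k mod Q) = 0 \<or> bitsum (k mod Q) = 1" by auto
        then have "k mod Q = 0 \<or> k mod Q = 2 ^ a" using e by auto
        moreover have k: "k = h * Q + k mod Q" using True by (metis div_mult_mod_eq)
        moreover have "k mod Q \<le> b" using \<open>k \<le> n\<close> k n by linarith
        ultimately show ?thesis by auto
      qed
      ultimately show ?thesis by blast
    next
      case False
      then have "G (k div Q) + 1 \<le> G h" using kh by (intro G_less) simp
      then have "1 - G h \<le> carries (2 * k) (n - k) - G (k div Q)" using c by simp
      then have "2 ^ a * (1 - G h) \<le> (2::int) ^ a * (carries (2 * k) (n - k) - G (k div Q))"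
        by (intro mult_left_mono) auto
      then have "M < w k" using wt [OF kQ] unfolding w [OF that] M_def
        by (simp add: algebra_simps) (smt (verit) zero_less_power)
      then show ?thesis by simp
    qed
  qed
  have low: "w (h * Q) = M"
  proof -
    have "carries (2 * (h * Q)) b = 0"
      using carries_split [of 0 "Suc a" b "2 * h" 0] b by (simp add: Q_def carries_def)
    then show ?thesis using Q w [of "h * Q"] n by (simp add: M_def)
  qed
  have high: "w (h * Q + 2 ^ a) = M" if "2 ^ a \<le> b"
  proof -
    have e: "n - (h * Q + 2 ^ a) = b - 2 ^ a" using n by simp
    have less: "b - 2 ^ a < 2 ^ Suc a" using b by (simp add: Q_def)
    have e2: "2 * (h * Q + 2 ^ a) = (2 * h + 1) * 2 ^ Suc a + 0" by (simp add: Q_def algebra_simps)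
    have "carries (2 * (h * Q + 2 ^ a)) (b - 2 ^ a) = 0"
      unfolding e2 using carries_split [of 0 "Suc a" "b - 2 ^ a" "2 * h + 1" 0] less by (simp add: carries_def)
    moreover have "(h * Q + 2 ^ a) div Q = h" "(h * Q + 2 ^ a) mod Q = 2 ^ a" using Q by simp_all
    moreover have "h * Q + 2 ^ a \<le> n" using that n by simp
    ultimately show ?thesis using w [of "h * Q + 2 ^ a"] e by (simp add: M_def)
  qed
  have nz: "coeff ?p k \<noteq> 0 \<longleftrightarrow> k \<le> n" for k
    by (simp add: coeff_shifted_legendre not_less)
  have "newton_edge (2 ^ a) ?p M (h * Q) (h * Q + (if b < 2 ^ a then 0 else 2 ^ a))"
    unfolding newton_edge_def w_def [symmetric] nz using ge low high n by auto
  then show ?thesis using that by (simp add: Q_def)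
qed

section \<open>Common factors\<close>

lemma val2_power2: "val2 (2 ^ k) = int k"
  by (simp add: val2_power)

lemma val2_cbin: "val2 (cbin r) = int (bitsum r) - 2 * int r"
proof -
  have "(4::rat) ^ r = 2 ^ (2 * r)" by (simp add: power_mult)
  then have "cbin r = fact (2 * r) / (fact r * fact r) / 2 ^ (2 * r)"
    unfolding cbin_def by (simp add: binomial_fact)
  then have "val2 (cbin r) = val2 (fact (2 * r)) - (val2 (fact r) + val2 (fact r)) - int (2 * r)"
    by (simp only: val2_divide val2_mult val2_power2 fact_nonzero mult_eq_0_iff power_not_zero
        zero_neq_numeral not_False_eq_True simp_thms divide_eq_0_iff)
  then show ?thesis by (simp add: val2_fact)
qed

text \<open>The odd factors of \<open>adams\<close> are 2-adic units, and the linear parts of the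
  valuations of the \<open>cbin\<close> cancel.\<close>

lemma adams_val2:
  assumes "r \<le> m" "m \<le> n"
  shows "adams n m r \<noteq> 0"
    and "val2 (adams n m r) = int (bitsum r) + int (bitsum (m - r)) + int (bitsum (n - r))
      - int (bitsum (n + m - r))"
proof -
  have odd_nz: "of_nat (2 * k + 1) \<noteq> (0::rat)" "val2 (of_nat (2 * k + 1)) = 0" for k
    unfolding of_nat_eq_0_iff by (simp, rule val2_odd_nat) simp
  show "adams n m r \<noteq> 0" unfolding adams_def using odd_nz by (simp only: divide_eq_0_iff mult_eq_0_iff cbin_nonzero simp_thms)
  have "val2 (adams n m r) = val2 (cbin r) + val2 (cbin (m - r)) + val2 (cbin (n - r)) - val2 (cbin (n + m - r))"
    unfolding adams_def using odd_nz
    by (simp only: val2_divide val2_mult divide_eq_0_iff mult_eq_0_iff cbin_nonzero simp_thms not_False_eq_True)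
  also have "\<dots> = int (bitsum r) + int (bitsum (m - r)) + int (bitsum (n - r)) - int (bitsum (n + m - r))"
    using assms by (simp add: val2_cbin of_nat_diff)
  finally show "val2 (adams n m r) = int (bitsum r) + int (bitsum (m - r)) + int (bitsum (n - r))
      - int (bitsum (n + m - r))" .
qed

section \<open>The primitive of the product and its edges\<close>

definition legendre_primitive :: "nat \<Rightarrow> rat poly" where
  "legendre_primitive K = pCons 0 (\<Sum>j\<le>K. monom (coeff (shifted_legendre K) j / of_nat (Suc j)) j)"

lemma coeff_legendre_primitive:
  "coeff (legendre_primitive K) 0 = 0"
  "coeff (legendre_primitive K) (Suc j) = coeff (shifted_legendre K) j / of_nat (Suc j)"
proof -
  have "coeff (shifted_legendre K) j = 0" if "\<not> j \<le> K"
    using that by (simp add: coeff_shifted_legendre binomial_eq_0)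
  then show "coeff (legendre_primitive K) (Suc j) = coeff (shifted_legendre K) j / of_nat (Suc j)"
    by (cases "j \<le> K") (simp_all add: legendre_primitive_def coeff_sum)
qed (simp add: legendre_primitive_def)

lemma pderiv_legendre_primitive: "pderiv (legendre_primitive K) = shifted_legendre K"
  by (rule poly_eqI) (simp add: coeff_pderiv coeff_legendre_primitive del: of_nat_Suc)

definition product_primitive :: "nat \<Rightarrow> nat \<Rightarrow> rat poly" where
  "product_primitive n m = (\<Sum>r\<le>m. smult (adams n m r) (legendre_primitive (n + m - 2 * r)))"

lemma pderiv_product_primitive:
  assumes "m \<le> n"
  shows "pderiv (product_primitive n m) = shifted_legendre m * shifted_legendre n"
  unfolding product_primitive_def adams_product [OF assms]
  by (simp add: higher_pderiv_sum [of 1, simplified] pderiv_smult pderiv_legendre_primitive)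

text \<open>By \<open>shifted_legendre_ode\<close> both sides have the same derivative, and both
  vanish at \<open>t = 0\<close>, which is the reason for the choice of the constant of
  integration.\<close>

lemma product_primitive_wronskian:
  assumes "m \<le> n"
  shows "smult (of_nat (n * (n + 1)) - of_nat (m * (m + 1))) (product_primitive n m) =
    [:0, 1, 1:] * pderiv (shifted_legendre n) * shifted_legendre m
    - [:0, 1, 1:] * pderiv (shifted_legendre m) * shifted_legendre n"
proof -
  let ?p = shifted_legendre and ?t = "[:0, 1, 1:] :: rat poly"
  define D where "D = smult (of_nat (n * (n + 1)) - of_nat (m * (m + 1))) (product_primitive n m)
    - (?t * pderiv (?p n) * ?p m - ?t * pderiv (?p m) * ?p n)"
  have "pderiv (?t * pderiv (?p n) * ?p m - ?t * pderiv (?p m) * ?p n)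
     = smult (of_nat (n * (n + 1)) - of_nat (m * (m + 1))) (?p m * ?p n)"
    unfolding pderiv_diff pderiv_mult [of "?t * pderiv (?p n)"] pderiv_mult [of "?t * pderiv (?p m)"]
      shifted_legendre_ode
    by (simp add: smult_diff_left algebra_simps)
  then have "pderiv D = 0"
    unfolding D_def pderiv_diff pderiv_smult pderiv_product_primitive [OF assms] by simp
  then have "degree D = 0" by (simp add: pderiv_eq_0_iff)
  then obtain d where d: "D = [:d:]" by (rule degree_eq_zeroE)
  have "coeff D 0 = 0"
    by (simp add: D_def product_primitive_def coeff_sum coeff_legendre_primitive coeff_mult_0 mult.assoc)
  then have "D = 0" by (simp add: d)
  then show ?thesis by (simp add: D_def)
qed

text \<open>The two terms of minimal weight belong to different powers of \<open>t\<close>, so each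
  dominates its coefficient and no cancellation occurs at the ends of the edge.\<close>

lemma product_primitive_edge:
  assumes "m < n" "a \<ge> 1" "2 ^ a \<le> n mod 2 ^ Suc a" "2 ^ a \<le> m mod 2 ^ Suc a"
  obtains M l where "newton_edge (2 ^ a) (product_primitive n m) M l (l + 2 ^ Suc a)"
proof -
  define h h' l l' where "h = n div 2 ^ Suc a" and "h' = m div 2 ^ Suc a"
    and "l = n mod 2 ^ Suc a - 2 ^ a" and "l' = m mod 2 ^ Suc a - 2 ^ a"
  interpret cb: common_bit a h h' l l'
  proof
    have "n mod 2 ^ Suc a < 2 ^ Suc a" "m mod 2 ^ Suc a < 2 ^ Suc a" by simp_all
    then show "l < 2 ^ a" "l' < 2 ^ a" using assms unfolding l_def l'_def power_Suc by linarith+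
  qed fact
  have n: "cb.n = n"
  proof -
    have "cb.n = h * 2 ^ Suc a + n mod 2 ^ Suc a" using assms unfolding cb.n_def unfolding l_def by linarith
    then show ?thesis unfolding h_def by (simp only: div_mult_mod_eq)
  qed
  have m: "cb.m = m"
  proof -
    have "cb.m = h' * 2 ^ Suc a + m mod 2 ^ Suc a" using assms unfolding cb.m_def unfolding l'_def by linarith
    then show ?thesis unfolding h'_def by (simp only: div_mult_mod_eq)
  qed
  have ne: "cb.n \<noteq> cb.m" using assms n m by simp
  obtain M r\<^sub>1 k\<^sub>1 r\<^sub>2 k\<^sub>2 where min: "cb.valid r\<^sub>1 k\<^sub>1" "cb.valid r\<^sub>2 k\<^sub>2" "k\<^sub>1 = k\<^sub>2 + 2 ^ Suc a"
    "2 ^ a * cb.cost r\<^sub>1 k\<^sub>1 - int k\<^sub>1 = M" "2 ^ a * cb.cost r\<^sub>2 k\<^sub>2 - int k\<^sub>2 = M"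
    "\<And>r k. cb.valid r k \<Longrightarrow> (r, k) \<noteq> (r\<^sub>1, k\<^sub>1) \<Longrightarrow> (r, k) \<noteq> (r\<^sub>2, k\<^sub>2) \<Longrightarrow>
       M < 2 ^ a * cb.cost r k - int k"
    by (rule cb.cost_two_minima [OF ne], rule that)
  define t where "t k r = coeff (smult (adams n m r) (legendre_primitive (n + m - 2 * r))) k" for k r
  have U: "coeff (product_primitive n m) k = sum (t k) {..m}" for k
    by (simp add: product_primitive_def coeff_sum t_def)
  have t_nz: "cb.valid r k" if tk: "t k r \<noteq> 0" "r \<le> m" for k r
  proof -
    obtain j where j: "k = Suc j"
      using tk by (cases k) (simp_all add: t_def coeff_legendre_primitive)
    then have "coeff (shifted_legendre (n + m - 2 * r)) j \<noteq> 0"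
      using that by (simp add: t_def coeff_legendre_primitive)
    then have "j \<le> n + m - 2 * r" by (simp add: coeff_shifted_legendre)
    then show ?thesis using that assms j unfolding cb.valid_def n m by simp
  qed
  \<comment> \<open>Dividing by \<open>k\<close> when integrating replaces
    \<open>bitsum (k - 1)\<close> by \<open>bitsum k - 1\<close>; hence the shift of the weight by
    \<open>2 ^ a\<close>.\<close>
  have t_val: "t k r \<noteq> 0 \<and> 2 ^ a * val2 (t k r) - int k = 2 ^ a * cb.cost r k - int k - 2 ^ a"
    if v: "cb.valid r k" for k r
  proof -
    have r: "r \<le> m" "m \<le> n" using v assms unfolding cb.valid_def n m by simp_all
    obtain j where j: "k = Suc j" using v unfolding cb.valid_def by (cases k) simp_all
    define K where "K = n + m - 2 * r"
    have jK: "j \<le> K" using v unfolding cb.valid_def n m j K_def by simp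
    have nz: "(of_nat (Suc j) :: rat) \<noteq> 0" by (simp del: of_nat_Suc)
    have t: "t k r = adams n m r * (coeff (shifted_legendre K) j / of_nat (Suc j))"
      by (simp add: t_def j coeff_legendre_primitive K_def del: of_nat_Suc)
    have "val2 (t k r) = val2 (adams n m r) + (int (bitsum j) + carries (2 * j) (K - j)) - val2 (of_nat (Suc j))"
      unfolding t using adams_val2(1) [OF r] coeff_shifted_legendre_val2 [OF jK] nz
      by (simp add: val2_mult val2_divide del: of_nat_Suc)
    also have "val2 (of_nat (Suc j)) = int (bitsum j) + 1 - int (bitsum k)"
      using bitsum_Suc [of j] j by simp
    \<comment> \<open>Adding and subtracting \<open>bitsum K\<close> splits the valuation into two
      carry counts.\<close>
    also have "val2 (adams n m r) = carries (n - r) (m - r) + carries K r"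
    proof -
      have "n - r + (m - r) = K" "K + r = n + m - r" using r by (simp_all add: K_def)
      then show ?thesis unfolding adams_val2(2) [OF r] carries_def by simp
    qed
    finally have "val2 (t k r) = cb.cost r k - 1"
      using jK unfolding cb.cost_def n m K_def [symmetric] j by simp
    then have "2 ^ a * val2 (t k r) - int k = 2 ^ a * (cb.cost r k - 1) - int k" by (simp only:)
    moreover have "t k r \<noteq> 0"
      unfolding t using adams_val2(1) [OF r] coeff_shifted_legendre_val2(1) [OF jK] nz by simp
    ultimately show ?thesis by (simp add: algebra_simps)
  qed
  have general: "\<exists>r. cb.valid r k \<and> val2 (t k r) \<le> val2 (coeff (product_primitive n m) k)"
    if "coeff (product_primitive n m) k \<noteq> 0" for k
  proof (rule ccontr)
    assume none: "\<not> ?thesis"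
    have "val2 (coeff (product_primitive n m) k) + 1 \<le> val2 (sum (t k) {..m})"
    proof (rule val2_sum_ge)
      fix r assume "r \<in> {..m}" "t k r \<noteq> 0"
      then have "\<not> val2 (t k r) \<le> val2 (coeff (product_primitive n m) k)"
        using none t_nz [of k r] by auto
      then show "val2 (coeff (product_primitive n m) k) + 1 \<le> val2 (t k r)" by simp
    qed (use that U in auto)
    then show False by (simp add: U)
  qed
  have ge: "M - 2 ^ a \<le> 2 ^ a * val2 (coeff (product_primitive n m) k) - int k \<and>
      (2 ^ a * val2 (coeff (product_primitive n m) k) - int k = M - 2 ^ a \<longrightarrow> k\<^sub>2 \<le> k \<and> k \<le> k\<^sub>1)"
    if nz: "coeff (product_primitive n m) k \<noteq> 0" for k
  proof -
    obtain r where r: "cb.valid r k" "val2 (t k r) \<le> val2 (coeff (product_primitive n m) k)"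
      using general [OF nz] by blast
    have le: "2 ^ a * val2 (t k r) \<le> 2 ^ a * val2 (coeff (product_primitive n m) k)"
      using r(2) by (intro mult_left_mono) auto
    show ?thesis
    proof (cases "(r, k) = (r\<^sub>1, k\<^sub>1) \<or> (r, k) = (r\<^sub>2, k\<^sub>2)")
      case True
      then have "2 ^ a * cb.cost r k - int k = M" using min by auto
      then have "M - 2 ^ a \<le> 2 ^ a * val2 (coeff (product_primitive n m) k) - int k"
        using le conjunct2 [OF t_val [OF r(1)]] by linarith
      then show ?thesis using True min(3) by auto
    next
      case False
      then have "M < 2 ^ a * cb.cost r k - int k" using min(6) [OF r(1)] by auto
      then have "M - 2 ^ a < 2 ^ a * val2 (coeff (product_primitive n m) k) - int k"
        using le conjunct2 [OF t_val [OF r(1)]] by linarith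
      then show ?thesis by simp
    qed
  qed
  have vertex: "coeff (product_primitive n m) k \<noteq> 0 \<and>
      2 ^ a * val2 (coeff (product_primitive n m) k) - int k = M - 2 ^ a"
    if rk: "(r, k) = (r\<^sub>1, k\<^sub>1) \<or> (r, k) = (r\<^sub>2, k\<^sub>2)" for r k
  proof -
    have v: "cb.valid r k" and c: "2 ^ a * cb.cost r k - int k = M" using rk min by auto
    have "sum (t k) {..m} \<noteq> 0 \<and> val2 (sum (t k) {..m}) = val2 (t k r)"
    proof (rule val2_sum_unique_min)
      show "r \<in> {..m}" using v unfolding cb.valid_def m by simp
      show "t k r \<noteq> 0" using t_val [OF v] by simp
      fix r' assume r': "r' \<in> {..m}" "r' \<noteq> r" "t k r' \<noteq> 0"
      have v': "cb.valid r' k" using t_nz r' by simp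
      moreover have "(r', k) \<noteq> (r\<^sub>1, k\<^sub>1)" "(r', k) \<noteq> (r\<^sub>2, k\<^sub>2)" using r' rk min(3) by auto
      ultimately have "M < 2 ^ a * cb.cost r' k - int k" by (rule min(6))
      then have "2 ^ a * val2 (t k r) < 2 ^ a * val2 (t k r')"
        using t_val [OF v] t_val [OF v'] c by linarith
      then show "val2 (t k r) < val2 (t k r')" by simp
    qed simp
    then show ?thesis using t_val [OF v] c by (simp add: U)
  qed
  have "newton_edge (2 ^ a) (product_primitive n m) (M - 2 ^ a) k\<^sub>2 k\<^sub>1"
    unfolding newton_edge_def using ge vertex [of r\<^sub>1 k\<^sub>1] vertex [of r\<^sub>2 k\<^sub>2] by blast
  then show ?thesis using that min(3) by blast
qed

text \<open>In characteristic 0 an irreducible \<open>g\<close> does not divide its derivative, so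
  each factor \<open>g\<close> of \<open>pderiv U\<close> forces one more factor \<open>g\<close> of
  \<open>U\<close>.\<close>

lemma cube_dvd_if_square_dvd_pderiv:
  fixes g U :: "rat poly"
  assumes irr: "irreducible g" and "g dvd U" "g ^ 2 dvd pderiv U"
  shows "g ^ 3 dvd U"
proof -
  have prime: "prime_elem g" using irr by (simp add: irreducible_imp_prime_elem)
  have deg: "degree g > 0" using irr by (metis irreducible_def is_unit_iff_degree not_gr_zero)
  then have ndvd: "\<not> g dvd pderiv g"
    by (metis degree_pderiv diff_less dvd_imp_degree_le less_le_not_le pderiv_eq_0_iff zero_less_one not_le)
  have step: "g dvd V" if "g dvd pderiv g * V" for V
    using that prime ndvd by (simp add: prime_elem_dvd_mult_iff)
  obtain V where V: "U = g * V" using assms(2) by blast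
  have "g dvd pderiv U" using assms(3) by (metis dvd_mult_left power2_eq_square)
  then have "g dvd pderiv g * V"
    unfolding V pderiv_mult by (simp add: dvd_add_right_iff mult.commute)
  then obtain W where W: "V = g * W" using step by blast
  have "pderiv U = g * (2 * (pderiv g * W) + g * pderiv W)"
    unfolding V W by (simp add: pderiv_mult algebra_simps)
  then have "g dvd 2 * (pderiv g * W) + g * pderiv W"
    using assms(3) deg by (auto simp: power2_eq_square)
  then have "g dvd smult 2 (pderiv g * W)"
    by (simp add: dvd_add_left_iff numeral_poly)
  then have "g dvd pderiv g * W" by (simp add: dvd_smult_iff)
  then obtain X where "W = g * X" using step by blast
  then show ?thesis unfolding V W by (simp add: power3_eq_cube)
qed


section \<open>Excluding common factors other than \<open>1 + 2 t\<close>\<close>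

lemma shifted_legendre_nonzero: "shifted_legendre n \<noteq> 0"
  using coeff_shifted_legendre [of n 0] by auto

text \<open>The linear factor of Bonnet's recurrence vanishes at \<open>-1/2\<close>, so the zero
  passes from each odd index to the next.\<close>

lemma shifted_legendre_odd_root:
  assumes "odd n"
  shows "poly (shifted_legendre n) (- 1 / 2) = 0"
proof -
  obtain k where "n = 2 * k + 1" using assms by (rule oddE)
  moreover have "poly (shifted_legendre (2 * k + 1)) (- 1 / 2) = 0" for k
  proof (induction k)
    case 0
    then show ?case using shifted_legendre_1 by simp
  next
    case (Suc k)
    have "of_nat (2 * k + 1 + 2) * poly (shifted_legendre (2 * k + 1 + 2)) (- 1 / 2) = 0"
      unfolding poly_smult [symmetric] shifted_legendre_rec by (simp add: Suc [simplified])
    then have "poly (shifted_legendre (2 * k + 1 + 2)) (- 1 / 2) = 0"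
      unfolding mult_eq_0_iff of_nat_eq_0_iff by simp
    then show ?case by (simp add: numeral_eq_Suc)
  qed
  ultimately show ?thesis by simp
qed

text \<open>Successive edges of the polygon of \<open>shifted_legendre n\<close> join: for
  \<open>k > 0\<close> the right end for \<open>q = 2 ^ k\<close> is the left end for
  \<open>q = 2 ^ (k - 1)\<close>.\<close>

lemma div_power2_Suc:
  "(n div 2 ^ Suc k) * 2 ^ Suc k + (if n mod 2 ^ Suc k < 2 ^ k then 0 else 2 ^ k) = (n div 2 ^ k) * (2::nat) ^ k"
proof -
  define q :: nat where "q = 2 ^ k"
  have q: "q > 0" by (simp add: q_def)
  define b where "b = n mod (2 * q)"
  have n: "n = n div (2 * q) * (2 * q) + b" unfolding b_def by (simp only: div_mult_mod_eq)
  have b: "b < 2 * q" using q by (simp add: b_def)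
  have "n div q = 2 * (n div (2 * q)) + b div q"
  proof -
    have "n = (2 * (n div (2 * q))) * q + b" using n by (simp add: mult_ac)
    then have "n div q = ((2 * (n div (2 * q))) * q + b) div q" by simp
    then show ?thesis using q by simp
  qed
  moreover have "b div q = (if b < q then 0 else 1)"
  proof (cases "b < q")
    case False
    then have "b = q + (b - q)" "b - q < q" using b by simp_all
    then have "b div q = 1" using q by (metis add.commute div_add_self2 div_less add_0 less_numeral_extra(3))
    then show ?thesis using False by simp
  qed simp
  ultimately have "n div q * q = n div (2 * q) * (2 * q) + (if b < q then 0 else q)"
    by (simp add: algebra_simps)
  then show ?thesis by (simp add: q_def b_def mult.commute)
qed

lemma common_divisor_trivial:
  fixes d :: "rat poly"
  assumes mn: "m < n" and d: "d dvd shifted_legendre n" "d dvd shifted_legendre m"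
    and root: "poly d (- 1 / 2) \<noteq> 0"
  shows "degree d = 0"
proof (rule ccontr)
  let ?p = shifted_legendre
  assume "degree d \<noteq> 0"
  moreover have "d \<noteq> 0" using root by auto
  ultimately obtain g where "g dvd d" "prime_elem g"
    using prime_divisor_exists [of d] by (auto simp: is_unit_iff_degree prime_def)
  then have irr: "irreducible g" and gn: "g dvd ?p n" and gm: "g dvd ?p m" and g_root: "poly g (- 1 / 2) \<noteq> 0"
    using d root by (auto intro: prime_elem_imp_irreducible dvd_trans elim!: dvdE)
  have deg: "degree g > 0" using irr by (metis irreducible_def is_unit_iff_degree not_gr_zero)
  then have g_nz: "g \<noteq> 0" by auto
  obtain f where f: "?p n = g * f" using gn by blast
  have split: "\<exists>l\<^sub>2 h\<^sub>2 M\<^sub>2. newton_edge (2 ^ a) f M\<^sub>2 l\<^sub>2 h\<^sub>2 \<and> (n div 2 ^ Suc a) * 2 ^ Suc a = l + l\<^sub>2 \<and>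
      (n div 2 ^ Suc a) * 2 ^ Suc a + (if n mod 2 ^ Suc a < 2 ^ a then 0 else 2 ^ a) = h + h\<^sub>2"
    if g: "newton_edge (2 ^ a) g M l h" for a M l h
  proof -
    obtain M' where e0: "newton_edge (2 ^ a) (g * f) M' (n div 2 ^ Suc a * 2 ^ Suc a)
        (n div 2 ^ Suc a * 2 ^ Suc a + (if n mod 2 ^ Suc a < 2 ^ a then 0 else 2 ^ a))"
      using shifted_legendre_edge [of a n] f by metis
    have q: "(0::int) < 2 ^ a" by simp
    obtain M\<^sub>1 l\<^sub>1 h\<^sub>1 M\<^sub>2 l\<^sub>2 h\<^sub>2 where e: "newton_edge (2 ^ a) g M\<^sub>1 l\<^sub>1 h\<^sub>1" "newton_edge (2 ^ a) f M\<^sub>2 l\<^sub>2 h\<^sub>2"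
      "n div 2 ^ Suc a * 2 ^ Suc a = l\<^sub>1 + l\<^sub>2"
      "n div 2 ^ Suc a * 2 ^ Suc a + (if n mod 2 ^ Suc a < 2 ^ a then 0 else 2 ^ a) = h\<^sub>1 + h\<^sub>2"
      by (rule newton_edge_factor [OF q e0], rule that)
    then show ?thesis using newton_edge_unique [OF g e(1)] by blast
  qed
  have span: "2 ^ a \<le> k mod 2 ^ Suc a \<and> h \<le> l + 2 ^ a"
    if g: "newton_edge (2 ^ a) g M l h" "l < h" and k: "g dvd ?p k" for a M l h k
  proof -
    obtain f' where f': "?p k = g * f'" using k by blast
    obtain M' where e0: "newton_edge (2 ^ a) (g * f') M' (k div 2 ^ Suc a * 2 ^ Suc a)
        (k div 2 ^ Suc a * 2 ^ Suc a + (if k mod 2 ^ Suc a < 2 ^ a then 0 else 2 ^ a))"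
      using shifted_legendre_edge [of a k] f' by metis
    have q: "(0::int) < 2 ^ a" by simp
    obtain M\<^sub>1 l\<^sub>1 h\<^sub>1 M\<^sub>2 l\<^sub>2 h\<^sub>2 where e: "newton_edge (2 ^ a) g M\<^sub>1 l\<^sub>1 h\<^sub>1" "newton_edge (2 ^ a) f' M\<^sub>2 l\<^sub>2 h\<^sub>2"
      "k div 2 ^ Suc a * 2 ^ Suc a = l\<^sub>1 + l\<^sub>2"
      "k div 2 ^ Suc a * 2 ^ Suc a + (if k mod 2 ^ Suc a < 2 ^ a then 0 else 2 ^ a) = h\<^sub>1 + h\<^sub>2"
      by (rule newton_edge_factor [OF q e0], rule that)
    have "l\<^sub>1 = l" "h\<^sub>1 = h" using newton_edge_unique [OF g(1) e(1)] by auto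
    moreover have "l\<^sub>2 \<le> h\<^sub>2" using e(2) by (rule newton_edge_le)
    ultimately show ?thesis using e(3,4) g(2) by (auto split: if_splits)
  qed
  \<comment> \<open>A proper edge of slope 1 in \<open>g\<close> makes \<open>n\<close> odd. As
    \<open>g\<close> does not vanish at \<open>-1/2\<close>, the factor \<open>1/2 + t\<close> of
    \<open>p_n\<close> then divides \<open>f\<close> and already uses up the edge of length
    1.\<close>
  have base: "l = h" if g: "newton_edge (2 ^ 0) g M l h" for M l h
  proof (rule ccontr)
    assume "l \<noteq> h"
    then have lh: "l < h" using newton_edge_le [OF g] by simp
    have "1 \<le> n mod 2" using span [OF g lh gn] by simp
    then have "odd n" by presburger
    then have "poly (?p n) (- 1 / 2) = 0" by (rule shifted_legendre_odd_root)
    then have "poly f (- 1 / 2) = 0" using f g_root by simp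
    then obtain f' where f': "f = [:1 / 2, 1:] * f'"
      by (metis dvdE minus_minus minus_divide_left poly_eq_0_iff_dvd)
    have x: "newton_edge (2 ^ 0) [:1 / 2, 1:] (-1) 0 1"
    proof -
      have "coeff [:1 / 2, 1 :: rat:] k = (if k = 0 then 1 / 2 else if k = 1 then 1 else 0)" for k
        by (cases k) (auto simp: coeff_pCons split: nat.splits)
      moreover have "val2 (1 / 2) = -1" by (simp add: val2_divide)
      ultimately show ?thesis unfolding newton_edge_def by auto
    qed
    have "f' \<noteq> 0" using f f' by (auto simp: shifted_legendre_nonzero)
    then obtain M' l' h' where e': "newton_edge (2 ^ 0) f' M' l' h'" by (rule newton_edge_exists)
    have ef: "newton_edge (2 ^ 0) f (-1 + M') (0 + l') (1 + h')"
      unfolding f' by (rule newton_edge_mult [OF _ x e']) simp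
    obtain l\<^sub>2 h\<^sub>2 M\<^sub>2 where s: "newton_edge (2 ^ 0) f M\<^sub>2 l\<^sub>2 h\<^sub>2"
      "(n div 2 ^ Suc 0) * 2 ^ Suc 0 = l + l\<^sub>2"
      "(n div 2 ^ Suc 0) * 2 ^ Suc 0 + (if n mod 2 ^ Suc 0 < 2 ^ 0 then 0 else 2 ^ 0) = h + h\<^sub>2"
      using split [OF g] by blast
    have "l\<^sub>2 = l'" "h\<^sub>2 = 1 + h'" using newton_edge_unique [OF s(1) ef] by simp_all
    then show False using s(2,3) newton_edge_le [OF e'] lh by (simp split: if_splits)
  qed
  \<comment> \<open>Without such an edge, all vertices of \<open>g\<close> would stay at
    \<open>degree g\<close> as \<open>a\<close> grows. But for \<open>a = n\<close> the left end in
    the polygon of \<open>p_n\<close> is 0, and so is that of its factor \<open>g\<close>.\<close>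
  have "\<exists>a M l h. a \<ge> 1 \<and> newton_edge (2 ^ a) g M l h \<and> l < h"
  proof (rule ccontr)
    assume none: "\<not> ?thesis"
    have all: "l = degree g \<and> h = degree g" if "newton_edge (2 ^ a) g M l h" for a M l h
      using that
    proof (induction a arbitrary: M l h)
      case 0
      obtain l\<^sub>2 h\<^sub>2 M\<^sub>2 where s: "newton_edge (2 ^ 0) f M\<^sub>2 l\<^sub>2 h\<^sub>2"
        "(n div 2 ^ Suc 0) * 2 ^ Suc 0 + (if n mod 2 ^ Suc 0 < 2 ^ 0 then 0 else 2 ^ 0) = h + h\<^sub>2"
        using split [OF 0] by blast
      have "n = (n div 2 ^ Suc 0) * 2 ^ Suc 0 + (if n mod 2 ^ Suc 0 < 2 ^ 0 then 0 else 2 ^ 0)"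
        by simp presburger
      then have "n = h + h\<^sub>2" using s(2) by simp
      moreover have "degree g + degree f = n"
        using degree_mult_eq [of g f] f degree_shifted_legendre [of n] shifted_legendre_nonzero [of n] by auto
      moreover have "h \<le> degree g" "h\<^sub>2 \<le> degree f"
        using newton_edge_le_degree 0 s(1) by blast+
      ultimately have "h = degree g" by simp
      then show ?case using base [OF 0] by simp
    next
      case (Suc a)
      obtain M' l' h' where e: "newton_edge (2 ^ a) g M' l' h'"
        by (rule newton_edge_exists [OF g_nz])
      then have IH: "l' = degree g" using Suc.IH by blast
      obtain l\<^sub>2 h\<^sub>2 M\<^sub>2 where s: "newton_edge (2 ^ a) f M\<^sub>2 l\<^sub>2 h\<^sub>2"
        "(n div 2 ^ Suc a) * 2 ^ Suc a = l' + l\<^sub>2"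
        using split [OF e] by blast
      obtain l\<^sub>3 h\<^sub>3 M\<^sub>3 where s': "newton_edge (2 ^ Suc a) f M\<^sub>3 l\<^sub>3 h\<^sub>3"
        "(n div 2 ^ Suc (Suc a)) * 2 ^ Suc (Suc a)
          + (if n mod 2 ^ Suc (Suc a) < 2 ^ Suc a then 0 else 2 ^ Suc a) = h + h\<^sub>3"
        using split [OF Suc.prems] by blast
      \<comment> \<open>Convexity gives an inequality for \<open>g\<close> and one for
        \<open>f\<close>. The corresponding ends add up to the same number, as the edges of
        \<open>p_n\<close> join, so both inequalities are equalities.\<close>
      have "h \<le> l'" "h\<^sub>3 \<le> l\<^sub>2"
        using newton_edge_consecutive [of "2 ^ a"] Suc.prems e s(1) s'(1) by auto
      moreover have "(n div 2 ^ Suc (Suc a)) * 2 ^ Suc (Suc a)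
          + (if n mod 2 ^ Suc (Suc a) < 2 ^ Suc a then 0 else 2 ^ Suc a) = (n div 2 ^ Suc a) * 2 ^ Suc a"
        by (rule div_power2_Suc)
      ultimately have "h = l'" using s(2) s'(2) by linarith
      moreover have "l = h" using none Suc.prems newton_edge_le [OF Suc.prems] by fastforce
      ultimately show ?case using IH by simp
    qed
    obtain M l h where e: "newton_edge (2 ^ n) g M l h"
      by (rule newton_edge_exists [OF g_nz])
    have "l = 0"
    proof -
      have "n < 2 ^ Suc n" by (metis less_exp less_SucI less_trans lessI)
      then show ?thesis using split [OF e] by auto
    qed
    then show False using all [OF e] deg by simp
  qed
  then obtain a M l h where a: "a \<ge> 1" and e: "newton_edge (2 ^ a) g M l h" and lh: "l < h"
    by blast
  have "(2::int) ^ a dvd int h - int l" by (rule newton_edge_dvd_diff [OF e])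
  then have "(2::int) ^ a \<le> int h - int l" using lh by (intro zdvd_imp_le) auto
  then have long: "int l + 2 ^ a \<le> int h" by simp
  let ?U = "product_primitive n m"
  have "g ^ 3 dvd ?U"
  proof (rule cube_dvd_if_square_dvd_pderiv [OF irr])
    have "of_nat (n * (n + 1)) - of_nat (m * (m + 1)) \<noteq> (0::rat)"
    proof -
      have "m * (m + 1) < n * (n + 1)" using mn by (intro mult_strict_mono) auto
      then show ?thesis by (metis of_nat_eq_iff eq_iff_diff_eq_0 less_irrefl)
    qed
    moreover have "g dvd smult (of_nat (n * (n + 1)) - of_nat (m * (m + 1))) ?U"
      unfolding product_primitive_wronskian [OF less_imp_le [OF mn]]
      using gn gm by (intro dvd_diff dvd_mult)
    ultimately show "g dvd ?U" by (metis dvd_smult_cancel)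
    show "g ^ 2 dvd pderiv ?U"
      unfolding pderiv_product_primitive [OF less_imp_le [OF mn]] power2_eq_square
      using gm gn by (rule mult_dvd_mono)
  qed
  then obtain V where V: "?U = g ^ 3 * V" by blast
  obtain M' l' where U: "newton_edge (2 ^ a) ?U M' l' (l' + 2 ^ Suc a)"
    using product_primitive_edge [OF mn a] span [OF e lh gn] span [OF e lh gm] by blast
  then have "V \<noteq> 0" using V by (auto simp: newton_edge_def)
  then obtain M'' l'' h'' where eV: "newton_edge (2 ^ a) V M'' l'' h''" by (rule newton_edge_exists)
  have q: "(2::int) ^ a > 0" by simp
  have "newton_edge (2 ^ a) ?U (M + (M + M) + M'') (l + (l + l) + l'') (h + (h + h) + h'')"
    unfolding V power3_eq_cube mult.assoc
    using newton_edge_mult [OF q e newton_edge_mult [OF q e newton_edge_mult [OF q e eV]]]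
    by (simp only: add.assoc)
  then have "l' = l + (l + l) + l''" "l' + 2 ^ Suc a = h + (h + h) + h''"
    using newton_edge_unique [OF U] by blast+
  moreover have "l + 2 ^ a \<le> h"
  proof -
    have "int (l + 2 ^ a) \<le> int h" using long by simp
    then show ?thesis by (simp only: of_nat_le_iff)
  qed
  moreover have "(2::nat) ^ a > 0" by simp
  ultimately show False using newton_edge_le [OF eV] unfolding power_Suc by linarith
qed

text \<open>Each factor \<open>1 + 2 t\<close> takes one unit of the edge of slope 1, whose length
  for \<open>shifted_legendre n\<close> is \<open>n mod 2\<close>.\<close>

lemma linear_power_dvd_shifted_legendre:
  assumes "[:1, 2:] ^ j dvd shifted_legendre n"
  shows "j \<le> n mod 2"
proof -
  have one: "newton_edge (2 ^ 0) 1 0 0 0"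
    unfolding newton_edge_def by auto
  have lin: "newton_edge (2 ^ 0) [:1, 2:] 0 0 1"
  proof -
    have "coeff [:1, 2 :: rat:] k = (if k = 0 then 1 else if k = 1 then 2 else 0)" for k
      by (cases k) (auto simp: coeff_pCons split: nat.splits)
    then show ?thesis unfolding newton_edge_def by auto
  qed
  have pow: "newton_edge (2 ^ 0) ([:1, 2:] ^ j) 0 0 j"
  proof (induction j)
    case 0
    then show ?case using one by simp
  next
    case (Suc j)
    then show ?case using newton_edge_mult [OF _ lin Suc] by simp
  qed
  obtain f where f: "shifted_legendre n = [:1, 2:] ^ j * f" using assms by blast
  have "f \<noteq> 0" using f shifted_legendre_nonzero [of n] by auto
  then obtain M l h where e: "newton_edge (2 ^ 0) f M l h" by (rule newton_edge_exists)
  have "newton_edge (2 ^ 0) (shifted_legendre n) (0 + M) (0 + l) (j + h)"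
    unfolding f by (rule newton_edge_mult [OF _ pow e]) simp
  moreover obtain M' where "newton_edge (2 ^ 0) (shifted_legendre n) M' (n div 2 ^ Suc 0 * 2 ^ Suc 0)
      (n div 2 ^ Suc 0 * 2 ^ Suc 0 + (if n mod 2 ^ Suc 0 < 2 ^ 0 then 0 else 2 ^ 0))"
    by (rule shifted_legendre_edge)
  ultimately have "0 + l = n div 2 ^ Suc 0 * 2 ^ Suc 0 \<and>
      j + h = n div 2 ^ Suc 0 * 2 ^ Suc 0 + (if n mod 2 ^ Suc 0 < 2 ^ 0 then 0 else 2 ^ 0)"
    using newton_edge_unique by blast
  then show ?thesis using newton_edge_le [OF e] by (auto split: if_splits)
qed

section \<open>From the rational gcd to complex roots\<close>

lemma poly_of_rat_gcd_eq_0: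
  fixes p q :: "rat poly" and z :: complex
  assumes "poly (map_poly of_rat p) z = 0" "poly (map_poly of_rat q) z = 0"
  shows "poly (map_poly of_rat (gcd p q)) z = 0"
proof -
  \<comment> \<open>Evaluation at \<open>z\<close> is shown to be additive and multiplicative, so
    that it can be applied to a Bezout identity for the gcd.\<close>
  define E where "E f = poly (map_poly of_rat f) z" for f :: "rat poly"
  have E_pCons: "E (pCons a f) = of_rat a + z * E f" for a f
    by (simp add: E_def map_poly_pCons)
  have zero: "E 0 = 0" by (simp add: E_def)
  have add: "E (f + g) = E f + E g" for f g
  proof (induction f g rule: poly_induct2)
    case (pCons a f b g)
    then show ?case by (simp add: E_pCons of_rat_add algebra_simps)
  qed (simp add: zero)
  have smult: "E (smult c f) = of_rat c * E f" for c f
    by (induction f) (simp_all add: zero E_pCons of_rat_mult algebra_simps)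
  have mult: "E (f * g) = E f * E g" for f g
    by (induction f) (simp_all add: zero E_pCons add smult algebra_simps)
  have "gcd p q = fst (bezout_coefficients p q) * p + snd (bezout_coefficients p q) * q"
    by (rule bezout_coefficients_fst_snd [symmetric])
  then have "E (gcd p q) = 0" using assms by (simp add: add mult flip: E_def)
  then show ?thesis by (simp add: E_def)
qed

theorem theorem1p1:
  fixes m n :: nat
  assumes "m < n"
  shows "\<not> (\<exists>z :: complex. z \<noteq> 0
            \<and> poly (map_poly of_rat (legendre_poly m)) z = 0
            \<and> poly (map_poly of_rat (legendre_poly n)) z = 0)
         \<and> gcd (legendre_poly m) (legendre_poly n)
            = (if odd m \<and> odd n then [:0, 1:] else 1)"
proof -
  define G where "G = gcd (legendre_poly m) (legendre_poly n)"
  have nz: "legendre_poly k \<noteq> 0" for k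
    using legendre_poly_pcompose [of k] shifted_legendre_nonzero [of k] by auto
  then have "G \<noteq> 0" by (simp add: G_def)
  have shift: "pcompose d [:1, 2:] dvd shifted_legendre k" if "d dvd legendre_poly k" for d k
    using that by (auto simp: pcompose_mult simp flip: legendre_poly_pcompose)
  \<comment> \<open>Once the power of \<open>x\<close> is split off,
    \<open>common_divisor_trivial\<close> applies to the cofactor, because \<open>x = 0\<close>
    corresponds to \<open>t = -1/2\<close>.\<close>
  obtain H where H: "G = [:- 0, 1:] ^ order 0 G * H" "\<not> [:- 0, 1:] dvd H"
    using order_decomp [OF \<open>G \<noteq> 0\<close>] by blast
  define k where "k = order 0 G"
  have GH: "G = [:0, 1:] ^ k * H" using H(1) by (simp add: k_def)
  have H0: "poly H 0 \<noteq> 0" using H(2) by (simp add: poly_eq_0_iff_dvd)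
  have dvd: "G dvd legendre_poly m" "G dvd legendre_poly n" by (simp_all add: G_def)
  then have "H dvd legendre_poly m" "H dvd legendre_poly n"
    using GH by (metis dvd_mult_right)+
  then have "pcompose H [:1, 2:] dvd shifted_legendre n" "pcompose H [:1, 2:] dvd shifted_legendre m"
    by (auto intro: shift)
  moreover have "poly (pcompose H [:1, 2:]) (- 1 / 2) \<noteq> 0"
    using H0 by (simp add: poly_pcompose)
  ultimately have "degree (pcompose H [:1, 2:]) = 0" by (rule common_divisor_trivial [OF assms])
  then have "degree H = 0" by (simp add: degree_pcompose)
  then obtain c where c: "H = [:c:]" by (rule degree_eq_zeroE)
  have "[:1, 2:] ^ k dvd shifted_legendre i" if "G dvd legendre_poly i" for i
  proof -
    have pow: "pcompose ([:0, 1:] ^ k) [:1, 2:] = ([:1, 2:] ^ k :: rat poly)"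
      by (induction k) (simp_all add: pcompose_mult pcompose_1 pcompose_pCons)
    have "[:0, 1:] ^ k dvd legendre_poly i" using that GH by (metis dvd_mult_left)
    then show ?thesis using shift pow by metis
  qed
  then have k: "k \<le> m mod 2" "k \<le> n mod 2"
    using dvd linear_power_dvd_shifted_legendre by blast+
  have k': "k = (if odd m \<and> odd n then 1 else 0)"
  proof (cases "odd m \<and> odd n")
    case True
    have "poly (legendre_poly i) 0 = 0" if "odd i" for i
      using shifted_legendre_odd_root [OF that]
      by (simp add: poly_pcompose flip: legendre_poly_pcompose)
    then have "[:0, 1:] dvd G"
      using True poly_eq_0_iff_dvd [of _ "0 :: rat"] by (simp add: G_def)
    moreover have "G = H" if "k = 0" using GH that by simp
    ultimately have "k \<noteq> 0" using H(2) by auto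
    then show ?thesis using k True by (simp add: odd_iff_mod_2_eq_one)
  next
    case False
    then show ?thesis using k by auto
  qed
  have "lead_coeff G = 1"
    unfolding G_def using nz by (intro lead_coeff_gcd_rat_poly) simp
  moreover have "lead_coeff G = c"
    unfolding GH c lead_coeff_mult lead_coeff_power by simp
  ultimately have "c = 1" by simp
  then have G: "G = (if odd m \<and> odd n then [:0, 1:] else 1)"
    using GH c k' by (auto simp: one_pCons)
  have "z = 0" if "poly (map_poly of_rat (legendre_poly m)) z = 0"
    "poly (map_poly of_rat (legendre_poly n)) z = 0" for z :: complex
    using poly_of_rat_gcd_eq_0 [OF that] G
    by (auto simp: map_poly_pCons simp flip: G_def split: if_splits)
  then show ?thesis using G by (auto simp: G_def)
qed

end
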